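(* For every $i\ge 1$ and every $N\ge 0$ there exist $2n\times 2n$ block matrices $\mathcal M^{l}_{t_i,N},\ \mathcal M^{l}_{s_i,N},\ \mathcal M^{r}_{t_i,N},\ \mathcal M^{r}_{s_i,N}$ (with $n\times n$ blocks), depending only on the matrices $\{x_j^l,y_j^l,x_j^r,y_j^r\}_{j}$ and on the spectral parameter $z$ (i.e. given by functions of these data that are the same for every symbol $\gamma$), such that $$\partial_{t_i}\begin{pmatrix}P^{(1)l}_N(z)\\ \tilde P^{(2)r}_N(z)\end{pmatrix}=\mathcal M^{l}_{t_i,N}\begin{pmatrix}P^{(1)l}_N(z)\\ \tilde P^{(2)r}_N(z)\end{pmatrix},\qquad \partial_{s_i}\begin{pmatrix}P^{(1)l}_N(z)\\ \tilde P^{(2)r}_N(z)\end{pmatrix}=\mathcal M^{l}_{s_i,N}\begin{pmatrix}P^{(1)l}_N(z)\\ \tilde P^{(2)r}_N(z)\end{pmatrix},$$ $$\partial_{t_i}\begin{pmatrix}P^{(1)r}_N(z)& \tilde P^{(2)l}_N(z)\end{pmatrix}=\begin{pmatrix}P^{(1)r}_N(z)& \tilde P^{(2)l}_N(z)\end{pmatrix}\mathcal M^{r}_{t_i,N},\qquad \partial_{s_i}\begin{pmatrix}P^{(1)r}_N(z)& \tilde P^{(2)l}_N(z)\end{pmatrix}=\begin{pmatrix}P^{(1)r}_N(z)& \tilde P^{(2)l}_N(z)\end{pmatrix}\mathcal M^{r}_{s_i,N}.$$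
   Context: Fix $n\ge1$; $\mathrm I$ is the $n\times n$ identity. Let $\gamma(z)=\sum_{k\in\mathbb Z}\gamma^{(k)}z^k$ be a formal series with $n\times n$ complex matrix coefficients. For times $t=(t_1,t_2,\dots)$, $s=(s_1,s_2,\dots)$ put $\xi(t,z)=\sum_{i\ge1}t_iz^i$ and define the time-dependent symbol $\gamma(t,s;z)=\exp(-\xi(s,z^{-1}\mathrm I))\,\gamma(z)\,\exp(\xi(t,z\mathrm I))$. This is understood so that its coefficients, again denoted $\gamma^{(k)}$, are well defined and differentiable in the times (e.g. as formal power series in the times), with $\partial_{t_i}\gamma=z^i\gamma$ and $\partial_{s_i}\gamma=-z^{-i}\gamma$. Let $T^r=(\gamma^{(i-j)})_{i,j\ge0}$ and $T^l=(\gamma^{(j-i)})_{i,j\ge0}$ be the semi-infinite block Toeplitz matrices, and let $T^r_N,T^l_N$ be their $N\times N$ block truncations ($0\le i,j\le N-1$). Standing assumption: at the values of $(t,s)$ considered, there are factorizations $T^l=S_1^{-1}S_2$ and $T^r=Z_2Z_1^{-1}$ with $S_1,Z_2$ block lower triangular with identity diagonal blocks and $S_2,Z_1$ block upper triangular with invertible diagonal blocks; consequently all $T^r_N,T^l_N$ are invertible. For matrix polynomials $P,Q$ let $P^*(z)=(P(z^{-1}))^{\mathrm T}$, $\langle P,Q\rangle_r=\oint P^*(z)\gamma(z)Q(z)\frac{dz}{2\pi i z}$, $\langle P,Q\rangle_l=\oint P(z)\gamma(z)Q^*(z)\frac{dz}{2\pi iz}$, where $\gamma(z)$ means $\gamma(t,s;z)$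 and $\oint\cdots\frac{dz}{2\pi i z}$ means taking the coefficient of $z^0$. The monic matrix polynomials $P^{(1)l}_N,P^{(2)l}_N,P^{(1)r}_N,P^{(2)r}_N$ (of degree $N$, leading coefficient $\mathrm I$, $N\ge0$) are the unique ones with $\langle P^{(1)l}_k,P^{(2)l}_j\rangle_l=0$ and $\langle P^{(2)r}_k,P^{(1)r}_j\rangle_r=0$ for $k\ne j$. They depend on $(t,s)$. For a matrix polynomial $Q$ of degree $N$, the reversed polynomial is $\tilde Q(z)=z^NQ^*(z)$. Reflection coefficients ($n\times n$ matrices): $x^l_N=P^{(1)l}_N(0)$, $x^r_N=P^{(1)r}_N(0)$, $y^l_N=(P^{(2)l}_N(0))^{\mathrm T}$, $y^r_N=(P^{(2)r}_N(0))^{\mathrm T}$. *)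

theory Defs
  imports
    "HOL-Analysis.Analysis"
    "HOL-Computational_Algebra.Formal_Power_Series"
    "HOL-Computational_Algebra.Polynomial"
begin

type_synonym 'n cmat = "complex^'n^'n"

text \<open>A formal series \<open>\<Sum>k\<in>\<int>. \<gamma>\<^sup>(\<^sup>k\<^sup>) z\<^sup>k\<close> is represented by its coefficient function.\<close>
type_synonym 'n symbol = "int \<Rightarrow> 'n cmat"

text \<open>Time sequences \<open>t\<^sub>1, t\<^sub>2, \<dots>\<close>; the value at index 0 is never used.\<close>
type_synonym times = "nat \<Rightarrow> complex"

type_synonym 'n semi_inf = "nat \<Rightarrow> nat \<Rightarrow> 'n cmat"

definition xi :: "times \<Rightarrow> complex fps" where
  "xi t = Abs_fps (\<lambda>i. if i = 0 then 0 else t i)"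

definition exp_xi :: "times \<Rightarrow> complex fps" where
  "exp_xi t = fps_exp 1 oo xi t"

definition has_matrix_derivative ::
  "(complex \<Rightarrow> complex^'c^'r) \<Rightarrow> complex^'c^'r \<Rightarrow> complex \<Rightarrow> bool" where
  "has_matrix_derivative F F' u \<longleftrightarrow>
     (\<forall>a b. ((\<lambda>v. F v $ a $ b) has_field_derivative F' $ a $ b) (at u))"

text \<open>
  \<open>D\<close> is the set of values \<open>(t, s)\<close> under consideration; it need only be open along each single
  time variable, so that the partial derivatives make sense. The series in the second conjunct is
  the coefficient of \<open>z\<^sup>k\<close> in \<open>exp (- \<xi>(s, z\<^sup>-\<^sup>1)) \<gamma>\<^sub>0(z) exp (\<xi>(t, z))\<close>, where
  \<open>exp_xi\<close> provides the coefficients of the two (scalar) exponentials.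
\<close>
definition time_dependent_symbol ::
  "'n::finite symbol \<Rightarrow> (times \<times> times) set \<Rightarrow> (times \<Rightarrow> times \<Rightarrow> 'n symbol) \<Rightarrow> bool" where
  "time_dependent_symbol \<gamma>0 D \<gamma> \<longleftrightarrow>
     (\<forall>(t, s) \<in> D. \<forall>i\<ge>1.
        (\<forall>\<^sub>F u in nhds (t i). (t(i := u), s) \<in> D) \<and>
        (\<forall>\<^sub>F u in nhds (s i). (t, s(i := u)) \<in> D)) \<and>
     (\<forall>(t, s) \<in> D. \<forall>k.
        ((\<lambda>(a, b). mat (fps_nth (exp_xi (\<lambda>i. - s i)) b) ** \<gamma>0 (k - int a + int b)
                     ** mat (fps_nth (exp_xi t) a))
           has_sum \<gamma> t s k) UNIV) \<and>
     (\<forall>(t, s) \<in> D. \<forall>i\<ge>1. \<forall>k.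
        has_matrix_derivative (\<lambda>u. \<gamma> (t(i := u)) s k) (\<gamma> t s (k - int i)) (t i) \<and>
        has_matrix_derivative (\<lambda>u. \<gamma> t (s(i := u)) k) (- \<gamma> t s (k + int i)) (s i))"

definition toeplitz_r :: "'n symbol \<Rightarrow> 'n semi_inf" where
  "toeplitz_r \<gamma> i j = \<gamma> (int i - int j)"

definition toeplitz_l :: "'n symbol \<Rightarrow> 'n semi_inf" where
  "toeplitz_l \<gamma> i j = \<gamma> (int j - int i)"

text \<open>
  Product of semi-infinite block matrices, meaningful when each of the sums has finite support,
  in particular when the left factor is lower or the right factor is upper triangular.
\<close>
definition semi_mult :: "'n::finite semi_inf \<Rightarrow> 'n semi_inf \<Rightarrow> 'n semi_inf" where
  "semi_mult A B i j = (\<Sum>k | A i k \<noteq> 0 \<and> B k j \<noteq> 0. A i k ** B k j)"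

definition semi_one :: "'n::finite semi_inf" where
  "semi_one i j = (if i = j then mat 1 else 0)"

definition semi_inverse :: "'n::finite semi_inf \<Rightarrow> 'n semi_inf \<Rightarrow> bool" where
  "semi_inverse A B \<longleftrightarrow> semi_mult A B = semi_one \<and> semi_mult B A = semi_one"

definition lower_unitriangular :: "'n::finite semi_inf \<Rightarrow> bool" where
  "lower_unitriangular A \<longleftrightarrow> (\<forall>i j. i < j \<longrightarrow> A i j = 0) \<and> (\<forall>i. A i i = mat 1)"

definition upper_invertible :: "'n::finite semi_inf \<Rightarrow> bool" where
  "upper_invertible A \<longleftrightarrow> (\<forall>i j. j < i \<longrightarrow> A i j = 0) \<and> (\<forall>i. invertible (A i i))"

definition factorizable :: "'n::finite symbol \<Rightarrow> bool" where
  "factorizable \<gamma> \<longleftrightarrow>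
     (\<exists>S1 S1' S2. lower_unitriangular S1 \<and> semi_inverse S1 S1' \<and> upper_invertible S2 \<and>
        toeplitz_l \<gamma> = semi_mult S1' S2) \<and>
     (\<exists>Z1 Z1' Z2. upper_invertible Z1 \<and> semi_inverse Z1 Z1' \<and> lower_unitriangular Z2 \<and>
        toeplitz_r \<gamma> = semi_mult Z2 Z1')"

text \<open>
  Polynomials with matrix coefficients; only the additive structure of the coefficient type is
  used, since the multiplication \<open>*\<close> on vectors is not the matrix product.
\<close>
type_synonym 'n matpoly = "'n cmat poly"

definition mp_eval :: "'n::finite matpoly \<Rightarrow> complex \<Rightarrow> 'n cmat" where
  "mp_eval P z = (\<Sum>k\<le>degree P. mat (z ^ k) ** coeff P k)"

definition mp_monic :: "nat \<Rightarrow> 'n::finite matpoly \<Rightarrow> bool" where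
  "mp_monic N P \<longleftrightarrow> degree P = N \<and> lead_coeff P = mat 1"

text \<open>\<open>z\<^sup>N Q\<^sup>*(z)\<close> where \<open>N\<close> is the degree of \<open>Q\<close> and \<open>Q\<^sup>*(z) = Q(z\<^sup>-\<^sup>1)\<^sup>T\<close>.\<close>
definition mp_reversed :: "'n::finite matpoly \<Rightarrow> 'n matpoly" where
  "mp_reversed Q = map_poly transpose (reflect_poly Q)"

text \<open>The coefficients of \<open>z\<^sup>0\<close> in \<open>P\<^sup>*(z) \<gamma>(z) Q(z)\<close> and in \<open>P(z) \<gamma>(z) Q\<^sup>*(z)\<close>.\<close>
definition pairing_r :: "'n::finite symbol \<Rightarrow> 'n matpoly \<Rightarrow> 'n matpoly \<Rightarrow> 'n cmat" where
  "pairing_r \<gamma> P Q = (\<Sum>a\<le>degree P. \<Sum>b\<le>degree Q.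
     transpose (coeff P a) ** \<gamma> (int a - int b) ** coeff Q b)"

definition pairing_l :: "'n::finite symbol \<Rightarrow> 'n matpoly \<Rightarrow> 'n matpoly \<Rightarrow> 'n cmat" where
  "pairing_l \<gamma> P Q = (\<Sum>a\<le>degree P. \<Sum>b\<le>degree Q.
     coeff P a ** \<gamma> (int b - int a) ** transpose (coeff Q b))"

definition biorthogonal_l ::
  "'n::finite symbol \<Rightarrow> (nat \<Rightarrow> 'n matpoly) \<Rightarrow> (nat \<Rightarrow> 'n matpoly) \<Rightarrow> bool" where
  "biorthogonal_l \<gamma> P1 P2 \<longleftrightarrow>
     (\<forall>N. mp_monic N (P1 N) \<and> mp_monic N (P2 N)) \<and>
     (\<forall>k j. k \<noteq> j \<longrightarrow> pairing_l \<gamma> (P1 k) (P2 j) = 0)"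

definition biorthogonal_r ::
  "'n::finite symbol \<Rightarrow> (nat \<Rightarrow> 'n matpoly) \<Rightarrow> (nat \<Rightarrow> 'n matpoly) \<Rightarrow> bool" where
  "biorthogonal_r \<gamma> P1 P2 \<longleftrightarrow>
     (\<forall>N. mp_monic N (P1 N) \<and> mp_monic N (P2 N)) \<and>
     (\<forall>k j. k \<noteq> j \<longrightarrow> pairing_r \<gamma> (P2 k) (P1 j) = 0)"

definition refl_x :: "(nat \<Rightarrow> 'n::finite matpoly) \<Rightarrow> nat \<Rightarrow> 'n cmat" where
  "refl_x P1 j = mp_eval (P1 j) 0"

definition refl_y :: "(nat \<Rightarrow> 'n::finite matpoly) \<Rightarrow> nat \<Rightarrow> 'n cmat" where
  "refl_y P2 j = transpose (mp_eval (P2 j) 0)"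

definition block_col :: "'n cmat \<Rightarrow> 'n cmat \<Rightarrow> complex^'n^('n + 'n)" where
  "block_col A B = (\<chi> a b. case a of Inl i \<Rightarrow> A $ i $ b | Inr i \<Rightarrow> B $ i $ b)"

definition block_row :: "'n cmat \<Rightarrow> 'n cmat \<Rightarrow> complex^('n + 'n)^'n" where
  "block_row A B = (\<chi> a b. case b of Inl j \<Rightarrow> A $ a $ j | Inr j \<Rightarrow> B $ a $ j)"

definition psi_l :: "(nat \<Rightarrow> 'n::finite matpoly) \<Rightarrow> (nat \<Rightarrow> 'n matpoly) \<Rightarrow> nat \<Rightarrow> complex
    \<Rightarrow> complex^'n^('n + 'n)" where
  "psi_l P1l P2r N z = block_col (mp_eval (P1l N) z) (mp_eval (mp_reversed (P2r N)) z)"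

definition psi_r :: "(nat \<Rightarrow> 'n::finite matpoly) \<Rightarrow> (nat \<Rightarrow> 'n matpoly) \<Rightarrow> nat \<Rightarrow> complex
    \<Rightarrow> complex^('n + 'n)^'n" where
  "psi_r P1r P2l N z = block_row (mp_eval (P1r N) z) (mp_eval (mp_reversed (P2l N)) z)"

end

theory Submission
  imports Defs
begin

text \<open>A constant invertible right factor of \<open>\<gamma>\<close> changes neither \<open>P\<^sup>(\<^sup>1\<^sup>)\<^sup>l\<close> nor \<open>P\<^sup>(\<^sup>2\<^sup>)\<^sup>r\<close>, and up to
  such a factor \<open>\<gamma>\<close> can be reconstructed from the values of these polynomials at \<open>0\<close>: in the
  orthogonality relations of degree \<open>N\<close>, prescribing the constant coefficient leaves a nondegenerate
  system of size \<open>N - 1\<close> for the other coefficients, and the remaining equation gives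
  \<open>\<gamma>\<^sup>(\<^sup>-\<^sup>N\<^sup>)\<close>, respectively \<open>\<gamma>\<^sup>(\<^sup>N\<^sup>)\<close>. Differentiating the orthogonality relations shows that the
  derivatives of the polynomials are determined by the same data. Hence both
  the wave matrix \<open>\<Psi>\<close> and its derivative \<open>\<Psi>'\<close> are functions of the reflection coefficients. By the
  Szego recursion \<open>\<Psi>\<close> has full column rank, so \<open>\<Psi>' = M \<Psi>\<close> can be solved for \<open>M\<close>. The right-hand
  polynomials are those of the transposed symbol.\<close>

subsection \<open>Linear systems depending on a parameter\<close>

lemma field_differentiable_cong_ev:
  assumes "\<forall>\<^sub>F u in nhds x. f u = g u" "g field_differentiable at x"
  shows "f field_differentiable at x"
  using assms DERIV_cong_ev[OF refl assms(1) refl] by (auto simp: field_differentiable_def)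

text \<open>Gaussian elimination, which avoids determinants of matrices of varying size.\<close>

lemma linear_system_solution_differentiable:
  fixes T :: "'a \<Rightarrow> 'b \<Rightarrow> complex \<Rightarrow> complex"
  assumes "finite I"
    and "\<And>a b. a \<in> I \<Longrightarrow> b \<in> J \<Longrightarrow> T a b field_differentiable at x"
    and "\<And>b. b \<in> J \<Longrightarrow> r b field_differentiable at x"
    and "\<And>b. b \<in> J \<Longrightarrow> \<forall>\<^sub>F u in nhds x. (\<Sum>a\<in>I. c a u * T a b u) = r b u"
    and "\<And>v a. (\<And>b. b \<in> J \<Longrightarrow> (\<Sum>a\<in>I. v a * T a b x) = 0) \<Longrightarrow> a \<in> I \<Longrightarrow> v a = 0"
  shows "\<forall>a\<in>I. c a field_differentiable at x"
  using assms
proof (induction I arbitrary: T r rule: finite_induct)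
  case empty
  then show ?case by simp
next
  case (insert a0 I)
  note T = insert.prems(1) and r = insert.prems(2) and sys = insert.prems(3)
    and ker = insert.prems(4)
  \<comment> \<open>A pivot exists: otherwise the unit vector at \<open>a0\<close> would solve the
    homogeneous system at \<open>x\<close>.\<close>
  have "\<exists>b0\<in>J. T a0 b0 x \<noteq> 0"
  proof (rule ccontr)
    assume *: "\<not> (\<exists>b0\<in>J. T a0 b0 x \<noteq> 0)"
    define v :: "'a \<Rightarrow> complex" where "v = (\<lambda>a. if a = a0 then 1 else 0)"
    have zero: "(\<Sum>a\<in>insert a0 I. v a * T a b x) = 0" if "b \<in> J" for b
    proof -
      have "(\<Sum>a\<in>I. v a * T a b x) = 0"
        using insert.hyps by (intro sum.neutral) (auto simp: v_def)
      then show ?thesis using * that insert.hyps by (simp add: v_def)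
    qed
    have "v a0 = 0" by (rule ker[of v a0, OF zero]) auto
    then show False by (simp add: v_def)
  qed
  then obtain b0 where b0: "b0 \<in> J" "T a0 b0 x \<noteq> 0" by blast
  define p where "p = T a0 b0"
  have p: "p field_differentiable at x" "p x \<noteq> 0"
    using T b0 by (auto simp: p_def)
  have "isCont p x" using p(1) by (rule field_differentiable_imp_continuous_at)
  then have "(p \<longlongrightarrow> p x) (nhds x)"
    by (simp add: continuous_at tendsto_nhds_iff)
  then have p_ev: "\<forall>\<^sub>F u in nhds x. p u \<noteq> 0"
    using p(2) by (rule tendsto_imp_eventually_ne)
  have sys0: "\<forall>\<^sub>F u in nhds x. c a0 u * p u + (\<Sum>a\<in>I. c a u * T a b0 u) = r b0 u"
    using sys[OF b0(1)] insert.hyps by (simp add: p_def)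
  \<comment> \<open>Equation \<open>b0\<close> eliminates the unknown \<open>c a0\<close>. All of
    \<open>J\<close> is kept: equation \<open>b0\<close> itself merely becomes trivial near
    \<open>x\<close>.\<close>
  have IH: "\<forall>a\<in>I. c a field_differentiable at x"
  proof (rule insert.IH[where T = "\<lambda>a b u. T a b u - T a b0 u * T a0 b u / p u"
        and r = "\<lambda>b u. r b u - r b0 u * T a0 b u / p u"])
    show "(\<lambda>u. T a b u - T a b0 u * T a0 b u / p u) field_differentiable at x"
      if "a \<in> I" "b \<in> J" for a b
      using that T p b0 by (intro derivative_intros) auto
    show "(\<lambda>u. r b u - r b0 u * T a0 b u / p u) field_differentiable at x" if "b \<in> J" for b
      using that T r p b0 by (intro derivative_intros) auto
  next
    fix b assume b: "b \<in> J"
    have "\<forall>\<^sub>F u in nhds x. c a0 u * T a0 b u + (\<Sum>a\<in>I. c a u * T a b u) = r b u"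
      using sys[OF b] insert.hyps by simp
    with sys0 p_ev show "\<forall>\<^sub>F u in nhds x. (\<Sum>a\<in>I. c a u * (T a b u - T a b0 u * T a0 b u / p u))
        = r b u - r b0 u * T a0 b u / p u"
    proof eventually_elim
      case (elim u)
      have "(\<Sum>a\<in>I. c a u * (T a b u - T a b0 u * T a0 b u / p u))
          = (\<Sum>a\<in>I. c a u * T a b u) - (\<Sum>a\<in>I. c a u * T a b0 u) * T a0 b u / p u"
        by (simp add: sum_subtractf sum_distrib_right sum_divide_distrib right_diff_distrib mult.assoc)
      then show ?case
        unfolding elim(1)[symmetric] elim(3)[symmetric] using elim(2) by (simp add: add_divide_distrib distrib_right)
    qed
  next
    fix v a
    assume v: "\<And>b. b \<in> J \<Longrightarrow> (\<Sum>a\<in>I. v a * (T a b x - T a b0 x * T a0 b x / p x)) = 0"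
      and a: "a \<in> I"
    \<comment> \<open>A kernel vector of the reduced system extends to one of the full system: its
      entry at \<open>a0\<close> is solved from equation \<open>b0\<close>.\<close>
    define w where "w = v(a0 := - (\<Sum>a\<in>I. v a * T a b0 x) / p x)"
    have "w a = 0"
    proof (rule ker[of w a])
      fix b assume "b \<in> J"
      have "(\<Sum>a\<in>I. w a * T a b x) = (\<Sum>a\<in>I. v a * T a b x)"
        using insert.hyps by (intro sum.cong) (auto simp: w_def)
      then have "(\<Sum>a\<in>insert a0 I. w a * T a b x)
          = (\<Sum>a\<in>I. v a * T a b x) - (\<Sum>a\<in>I. v a * T a b0 x) * T a0 b x / p x"
        using insert.hyps by (simp add: w_def)
      also have "\<dots> = (\<Sum>a\<in>I. v a * (T a b x - T a b0 x * T a0 b x / p x))"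
        by (simp add: sum_subtractf sum_distrib_right sum_divide_distrib right_diff_distrib mult.assoc)
      also have "\<dots> = 0" using v \<open>b \<in> J\<close> .
      finally show "(\<Sum>a\<in>insert a0 I. w a * T a b x) = 0" .
    qed (use a in simp)
    then show "v a = 0" using a insert.hyps by (auto simp: w_def split: if_splits)
  qed
  have "c a0 field_differentiable at x"
  proof (rule field_differentiable_cong_ev)
    show "\<forall>\<^sub>F u in nhds x. c a0 u = (r b0 u - (\<Sum>a\<in>I. c a u * T a b0 u)) / p u"
      using sys0 p_ev by eventually_elim (simp add: nonzero_eq_divide_eq eq_diff_eq)
    show "(\<lambda>u. (r b0 u - (\<Sum>a\<in>I. c a u * T a b0 u)) / p u) field_differentiable at x"
      using IH T r p b0 by (intro derivative_intros) auto
  qed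
  with IH show ?case by simp
qed

subsection \<open>Matrices\<close>

lemma matrix_add_rdistrib:
  fixes A :: "'a::semiring_1^'n^'m"
  shows "(A + B) ** C = A ** C + B ** C"
  by (vector matrix_matrix_mult_def sum.distrib[symmetric] distrib_right)

lemma matrix_mult_sum_left:
  fixes f :: "'i \<Rightarrow> 'a::semiring_1^'n^'m"
  shows "(\<Sum>a\<in>I. f a) ** B = (\<Sum>a\<in>I. f a ** B)"
  by (induction I rule: infinite_finite_induct) (auto simp: matrix_add_rdistrib)

lemma matrix_mult_sum_right:
  fixes f :: "'i \<Rightarrow> 'a::semiring_1^'n^'m"
  shows "B ** (\<Sum>a\<in>I. f a) = (\<Sum>a\<in>I. B ** f a)"
  by (induction I rule: infinite_finite_induct) (auto simp: matrix_add_ldistrib)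

lemma matrix_diff_rdistrib:
  fixes A :: "'a::ring_1^'n^'m"
  shows "(A - B) ** C = A ** C - B ** C"
  by (simp add: eq_diff_eq flip: matrix_add_rdistrib)

lemma matrix_diff_ldistrib:
  fixes A :: "'a::ring_1^'n^'m"
  shows "A ** (B - C) = A ** B - A ** C"
  by (simp add: eq_diff_eq flip: matrix_add_ldistrib)

lemma mat_mult_nth:
  fixes A :: "'a::comm_semiring_1^'n^'m"
  shows "(mat c ** A) $ i $ j = c * A $ i $ j"
  by (simp add: matrix_matrix_mult_def mat_def if_distrib if_distribR cong: if_cong)

lemma mat_mult_commute:
  fixes A :: "'a::comm_semiring_1^'n^'m"
  shows "A ** mat c = mat c ** A"
proof -
  have "(A ** mat c) $ i $ j = A $ i $ j * c" for i j
    by (simp add: matrix_matrix_mult_def mat_def if_distrib cong: if_cong)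
  then show ?thesis by (simp add: vec_eq_iff mat_mult_nth mult.commute)
qed

lemma transpose_sum: "transpose (\<Sum>a\<in>I. f a) = (\<Sum>a\<in>I. transpose (f a))"
  by (simp add: vec_eq_iff transpose_def)

lemma transpose_zero: "transpose 0 = 0"
  by (simp add: vec_eq_iff transpose_def)

lemma transpose_eq_zero_iff: "transpose A = 0 \<longleftrightarrow> A = 0"
  using transpose_iff[of A 0] by (simp only: transpose_zero)

text \<open>A kernel vector of \<open>transpose K\<close>, repeated as every row, gives a square
  matrix \<open>A\<close> with \<open>A ** K = 0\<close>. Testing with square matrices matches the
  matrix coefficients in \<open>nondegenerate\<close>.\<close>

lemma invertible_if_left_cancel:
  fixes K :: "'a::field^'n^'n"
  assumes "\<And>A :: 'a^'n^'n. A ** K = 0 \<Longrightarrow> A = 0"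
  shows "invertible K"
proof -
  have "x = 0" if "transpose K *v x = 0" for x
  proof -
    have "(\<chi> i. x) ** K = (0 :: 'a^'n^'n)"
      using that by (simp add: vec_eq_iff matrix_matrix_mult_def matrix_vector_mult_def
          transpose_def mult.commute[of "x $ _"])
    then have "(\<chi> i. x) = (0 :: 'a^'n^'n)" by (rule assms)
    then show ?thesis by (simp add: vec_eq_iff)
  qed
  then have "\<exists>B. B ** transpose K = mat 1"
    by (simp add: matrix_left_invertible_ker del: transpose_matrix_vector)
  then show ?thesis by (simp add: left_invertible_transpose invertible_right_inverse)
qed

lemma invertible_mult_right_eq_zero_iff:
  fixes K :: "'a::field^'n^'n"
  assumes "invertible K"
  shows "A ** K = 0 \<longleftrightarrow> A = 0"
proof
  obtain L where "K ** L = mat 1" using assms by (auto simp: invertible_def)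
  moreover assume "A ** K = 0"
  then have "A ** (K ** L) = 0" by (simp add: matrix_mul_assoc)
  ultimately show "A = 0" by simp
qed simp

text \<open>The trivial kernel provides a left inverse \<open>B\<close> of \<open>P\<close>, and
  \<open>M = Q ** B\<close>. The intended \<open>P\<close> is a wave matrix, with twice as many rows
  as columns.\<close>

lemma matrix_left_quotient:
  fixes P :: "'a::field^'m^'n" and Q :: "'a^'m^'k"
  assumes "\<And>v. P *v v = 0 \<Longrightarrow> v = 0"
  shows "\<exists>M. Q = M ** P"
proof -
  have "\<exists>B. B ** P = mat 1" unfolding matrix_left_invertible_ker using assms by blast
  then obtain B where B: "B ** P = mat 1" ..
  have "Q = (Q ** B) ** P" unfolding matrix_mul_assoc[symmetric] B by simp
  then show ?thesis ..
qed

subsection \<open>Monic orthogonal coefficients of a nondegenerate symbol\<close>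

text \<open>The matrices with trivial left kernel are the truncations \<open>T\<^sup>l\<^sub>N\<close>.\<close>

definition nondegenerate :: "'n::finite symbol \<Rightarrow> bool" where
  "nondegenerate g \<longleftrightarrow> (\<forall>N (c :: nat \<Rightarrow> 'n cmat).
     (\<forall>b<N. (\<Sum>a<N. c a ** g (int b - int a)) = 0) \<longrightarrow> (\<forall>a<N. c a = 0))"

text \<open>The numbers \<open>p N a\<close> are the coefficients of the left polynomials \<open>P\<^sup>(\<^sup>1\<^sup>)\<^sup>l\<^sub>N\<close> of \<open>g\<close>. For the
  symbol \<open>g (- k)\<close> one obtains the transposed coefficients of \<open>P\<^sup>(\<^sup>2\<^sup>)\<^sup>r\<^sub>N\<close>.\<close>

definition monic_orthogonal :: "'n::finite symbol \<Rightarrow> (nat \<Rightarrow> nat \<Rightarrow> 'n cmat) \<Rightarrow> bool" where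
  "monic_orthogonal g p \<longleftrightarrow>
     (\<forall>N. p N N = mat 1 \<and> (\<forall>b<N. (\<Sum>a\<le>N. p N a ** g (int b - int a)) = 0))"

lemma nondegenerateD:
  fixes c :: "nat \<Rightarrow> 'n::finite cmat"
  assumes "nondegenerate g" "\<And>b. b < N \<Longrightarrow> (\<Sum>a<N. c a ** g (int b - int a)) = 0" "a < N"
  shows "c a = 0"
  using assms(1)[unfolded nondegenerate_def, THEN spec, THEN spec, of N c] assms(2,3) by simp

lemma monic_orthogonal_leading: "monic_orthogonal g p \<Longrightarrow> p N N = mat 1"
  and monic_orthogonal_sum:
    "monic_orthogonal g p \<Longrightarrow> b < N \<Longrightarrow> (\<Sum>a\<le>N. p N a ** g (int b - int a)) = 0"
  by (auto simp: monic_orthogonal_def)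

text \<open>Reversing the order of block rows and block columns, \<open>a\<close> to
  \<open>N - 1 - a\<close>, carries the truncation with entries \<open>g (b - a)\<close> to the one
  with entries \<open>g (a - b)\<close>.\<close>

lemma nondegenerate_reflect:
  assumes "nondegenerate g"
  shows "nondegenerate (\<lambda>k. g (- k))"
  unfolding nondegenerate_def
proof (intro allI impI)
  fix N a and c :: "nat \<Rightarrow> 'a cmat"
  assume c: "\<forall>b<N. (\<Sum>a<N. c a ** g (- (int b - int a))) = 0" and a: "a < N"
  have "c (N - Suc (N - Suc a)) = 0"
  proof (rule nondegenerateD[OF assms, where c = "\<lambda>a. c (N - Suc a)"])
    fix b assume b: "b < N"
    have "(\<Sum>a<N. c (N - Suc a) ** g (int b - int a))
        = (\<Sum>a<N. c (N - Suc a) ** g (- (int (N - Suc b) - int (N - Suc a))))"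
      using b by (intro sum.cong refl arg_cong2[of _ _ _ _ "(**)"] arg_cong[of _ _ g]) auto
    also have "\<dots> = (\<Sum>a<N. c a ** g (- (int (N - Suc b) - int a)))"
      by (rule sum.nat_diff_reindex)
    also have "\<dots> = 0" by (rule c[rule_format]) (use b in simp)
    finally show "(\<Sum>a<N. c (N - Suc a) ** g (int b - int a)) = 0" .
  qed (use a in auto)
  then show "c a = 0" using a by (simp add: Suc_diff_Suc)
qed

lemma nondegenerate_invertible:
  fixes g :: "'n::finite symbol"
  assumes "nondegenerate g"
  shows "invertible (g 0)"
proof (rule invertible_if_left_cancel)
  fix A :: "'n cmat" assume "A ** g 0 = 0"
  then show "A = 0"
    using nondegenerateD[OF assms, of 1 "\<lambda>_. A" 0] by simp
qed

lemma nondegenerate_mult_right: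
  assumes "nondegenerate g" "invertible C"
  shows "nondegenerate (\<lambda>k. g k ** C)"
  unfolding nondegenerate_def
proof (intro allI impI)
  fix N a and c :: "nat \<Rightarrow> 'a cmat"
  assume c: "\<forall>b<N. (\<Sum>a<N. c a ** (g (int b - int a) ** C)) = 0" and a: "a < N"
  show "c a = 0"
  proof (rule nondegenerateD[OF assms(1) _ a])
    fix b assume "b < N"
    then have "(\<Sum>a<N. c a ** g (int b - int a)) ** C = 0"
      using c by (simp add: matrix_mult_sum_left matrix_mul_assoc)
    then show "(\<Sum>a<N. c a ** g (int b - int a)) = 0"
      by (simp add: invertible_mult_right_eq_zero_iff[OF assms(2)])
  qed
qed

lemma monic_orthogonal_mult_right:
  assumes "monic_orthogonal g p"
  shows "monic_orthogonal (\<lambda>k. g k ** C) p"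
  using assms unfolding monic_orthogonal_def
  by (simp add: matrix_mul_assoc flip: matrix_mult_sum_left)

subsection \<open>Reconstruction from the reflection coefficients\<close>

lemma sum_atMost_Suc_inner: "(\<Sum>a\<le>Suc M. f a) = f 0 + (\<Sum>a<M. f (Suc a)) + f (Suc M)"
  unfolding sum.atMost_Suc[of f M] lessThan_Suc_atMost[of M, symmetric] sum.lessThan_Suc_shift ..

text \<open>The relations with \<open>0 < b < N\<close> involve only coefficients at which
  \<open>h\<close> and \<open>g\<close> agree. Since \<open>p\<close> and \<open>q\<close> have
  equal ends, the inner part of \<open>p - q\<close> is annihilated by the truncation of size
  \<open>N - 1\<close>. Once \<open>p = q\<close>, the relation \<open>b = 0\<close> has
  \<open>h (- N)\<close> as its only unknown, multiplied by the leading coefficient 1.\<close>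

lemma symbol_step:
  fixes g h :: "'n::finite symbol"
  assumes g: "nondegenerate g"
    and eq: "\<And>k. \<bar>k\<bar> < int N \<Longrightarrow> h k = g k" and "N > 0"
    and lead: "p N = mat 1" "q N = mat 1" and "p 0 = q 0"
    and p: "\<And>b. b < N \<Longrightarrow> (\<Sum>a\<le>N. p a ** h (int b - int a)) = 0"
    and q: "\<And>b. b < N \<Longrightarrow> (\<Sum>a\<le>N. q a ** g (int b - int a)) = 0"
  shows "h (- int N) = g (- int N)" and "a \<le> N \<Longrightarrow> p a = q a"
proof -
  obtain M where M: "N = Suc M" using \<open>N > 0\<close> by (cases N) auto
  have inner: "p (Suc a) - q (Suc a) = 0" if "a < M" for a
  proof (rule nondegenerateD[OF g _ that])
    fix b assume b: "b < M"
    \<comment> \<open>Both indices move up by one, which leaves \<open>b - a\<close> unchanged; the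
      added end terms \<open>a = 0\<close> and \<open>a = N\<close> vanish.\<close>
    have "(\<Sum>a<M. (p (Suc a) - q (Suc a)) ** g (int b - int a))
        = (\<Sum>a\<le>N. (p a - q a) ** g (int (Suc b) - int a))"
      using lead \<open>p 0 = q 0\<close> by (simp add: M sum_atMost_Suc_inner del: sum.atMost_Suc)
    also have "\<dots> = (\<Sum>a\<le>N. p a ** g (int (Suc b) - int a)) - (\<Sum>a\<le>N. q a ** g (int (Suc b) - int a))"
      unfolding matrix_diff_rdistrib sum_subtractf ..
    also have "(\<Sum>a\<le>N. p a ** g (int (Suc b) - int a)) = (\<Sum>a\<le>N. p a ** h (int (Suc b) - int a))"
    proof (rule sum.cong)
      fix a assume "a \<in> {..N}"
      then have "h (int (Suc b) - int a) = g (int (Suc b) - int a)" using b M by (intro eq) auto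
      then show "p a ** g (int (Suc b) - int a) = p a ** h (int (Suc b) - int a)" by simp
    qed simp
    also have "\<dots> - (\<Sum>a\<le>N. q a ** g (int (Suc b) - int a)) = 0"
      using p[of "Suc b"] q[of "Suc b"] b M by simp
    finally show "(\<Sum>a<M. (p (Suc a) - q (Suc a)) ** g (int b - int a)) = 0" .
  qed
  show pq: "p a = q a" if "a \<le> N" for a
  proof (cases a)
    case (Suc a')
    then show ?thesis using inner[of a'] that lead M by (cases "a' = M") auto
  qed (use \<open>p 0 = q 0\<close> in simp)
  have "(\<Sum>a\<le>N. p a ** h (int 0 - int a)) = (\<Sum>a\<le>N. q a ** g (int 0 - int a))"
    using p[of 0] q[of 0] \<open>N > 0\<close> by simp
  moreover have "(\<Sum>a<N. p a ** h (int 0 - int a)) = (\<Sum>a<N. q a ** g (int 0 - int a))"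
    by (intro sum.cong refl arg_cong2[of _ _ _ _ "(**)"] eq pq) auto
  ultimately show "h (- int N) = g (- int N)"
    using lead by (simp flip: lessThan_Suc_atMost)
qed

text \<open>Induction on the absolute value of \<open>k\<close>, started by
  \<open>h 0 = g 0\<close>. Degree \<open>N\<close> of \<open>p\<close> determines the coefficient
  at \<open>- N\<close>; degree \<open>N\<close> of \<open>q\<close>, which belongs to the reflected
  symbol, determines the one at \<open>N\<close>.\<close>

lemma symbol_unique:
  fixes g h :: "'n::finite symbol"
  assumes g: "nondegenerate g" "monic_orthogonal g p'" "monic_orthogonal (\<lambda>k. g (- k)) q'"
    and h: "monic_orthogonal h p" "monic_orthogonal (\<lambda>k. h (- k)) q"
    and x: "\<And>N. p N 0 = p' N 0" and y: "\<And>N. q N 0 = q' N 0"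
    and "h 0 = g 0"
  shows "h k = g k" and "a \<le> N \<Longrightarrow> p N a = p' N a" and "a \<le> N \<Longrightarrow> q N a = q' N a"
proof -
  have step: "h (- int N) = g (- int N) \<and> h (int N) = g (int N) \<and> (\<forall>a\<le>N. p N a = p' N a \<and> q N a = q' N a)"
    if "N > 0" and eq: "\<And>k. \<bar>k\<bar> < int N \<Longrightarrow> h k = g k" for N
  proof -
    have eq': "h (- k) = g (- k)" if "\<bar>k\<bar> < int N" for k using eq[of "- k"] that by simp
    note 1 = symbol_step[of g N h "p N" "p' N", OF g(1) eq \<open>N > 0\<close>
        h(1)[THEN monic_orthogonal_leading] g(2)[THEN monic_orthogonal_leading] x
        h(1)[THEN monic_orthogonal_sum] g(2)[THEN monic_orthogonal_sum]]
    note 2 = symbol_step[of "\<lambda>k. g (- k)" N "\<lambda>k. h (- k)" "q N" "q' N",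
        OF nondegenerate_reflect[OF g(1)] eq' \<open>N > 0\<close>
        h(2)[THEN monic_orthogonal_leading] g(3)[THEN monic_orthogonal_leading] y
        h(2)[THEN monic_orthogonal_sum] g(3)[THEN monic_orthogonal_sum]]
    show ?thesis using 1(1) 1(2) 2(1) 2(2) by (simp only: minus_minus) blast
  qed
  have *: "\<forall>k. \<bar>k\<bar> \<le> int N \<longrightarrow> h k = g k" for N
  proof (induction N)
    case 0
    then show ?case using \<open>h 0 = g 0\<close> by simp
  next
    case (Suc N)
    have "h (- int (Suc N)) = g (- int (Suc N)) \<and> h (int (Suc N)) = g (int (Suc N))"
      using step[of "Suc N"] Suc by simp
    note new = this
    show ?case
    proof (intro allI impI)
      fix k assume "\<bar>k\<bar> \<le> int (Suc N)"
      then consider "\<bar>k\<bar> \<le> int N" | "k = int (Suc N)" | "k = - int (Suc N)" by linarith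
      then show "h k = g k" using new Suc by cases (simp_all only:)
    qed
  qed
  show hg: "h k = g k" for k by (rule *[of "nat \<bar>k\<bar>", rule_format]) simp
  have "p N a = p' N a \<and> q N a = q' N a" if "a \<le> N"
  proof (cases "N = 0")
    case True
    then show ?thesis using that g(2,3)[THEN monic_orthogonal_leading] h[THEN monic_orthogonal_leading] by simp
  next
    case False
    then show ?thesis using step[of N, OF _ hg] that by blast
  qed
  then show "a \<le> N \<Longrightarrow> p N a = p' N a" "a \<le> N \<Longrightarrow> q N a = q' N a" by auto
qed

lemma symbol_unique_up_to_factor:
  fixes g h :: "'n::finite symbol"
  assumes g: "nondegenerate g" "monic_orthogonal g p'" "monic_orthogonal (\<lambda>k. g (- k)) q'"
    and h: "nondegenerate h" "monic_orthogonal h p" "monic_orthogonal (\<lambda>k. h (- k)) q"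
    and xy: "\<And>N. p N 0 = p' N 0" "\<And>N. q N 0 = q' N 0"
  obtains C where "invertible C" "\<And>k. h k = g k ** C"
    "\<And>N a. a \<le> N \<Longrightarrow> p N a = p' N a" "\<And>N a. a \<le> N \<Longrightarrow> q N a = q' N a"
proof -
  obtain L where L: "g 0 ** L = mat 1" "L ** g 0 = mat 1"
    using nondegenerate_invertible[OF g(1)] by (auto simp: invertible_def)
  \<comment> \<open>The factor that normalises the coefficient at 0, as
    \<open>g 0 ** C = h 0\<close>.\<close>
  define C where "C = L ** h 0"
  have "invertible L" using L by (auto simp: invertible_def)
  then have C: "invertible C"
    using nondegenerate_invertible[OF h(1)] by (simp add: C_def invertible_mult)
  have "h 0 = g 0 ** C" by (simp add: C_def matrix_mul_assoc L)
  note u = symbol_unique[OF nondegenerate_mult_right[OF g(1) C]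
      monic_orthogonal_mult_right[OF g(2)] monic_orthogonal_mult_right[OF g(3)] h(2,3) xy this]
  show ?thesis using that[OF C u] .
qed

section \<open>First variation of the orthogonal coefficients\<close>

text \<open>The linearised orthogonality relations in degree \<open>N\<close>, when the symbol moves
  in direction \<open>g'\<close>. The coefficient \<open>p' N\<close> vanishes because the leading
  coefficient stays 1. No curve of symbols is mentioned, so variations of different symbols can be
  compared.\<close>

definition variation ::
  "'n::finite symbol \<Rightarrow> 'n symbol \<Rightarrow> nat \<Rightarrow> (nat \<Rightarrow> 'n cmat) \<Rightarrow> (nat \<Rightarrow> 'n cmat) \<Rightarrow> bool" where
  "variation g g' N p p' \<longleftrightarrow> p' N = 0 \<and>
     (\<forall>b<N. (\<Sum>a\<le>N. p' a ** g (int b - int a)) + (\<Sum>a\<le>N. p a ** g' (int b - int a)) = 0)"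

text \<open>After cancelling \<open>C\<close>, both \<open>q'\<close> and \<open>p'\<close> solve
  the same inhomogeneous system. Their difference has no coefficient at \<open>N\<close>, so the
  truncation of size \<open>N\<close> annihilates it.\<close>

lemma variation_unique:
  fixes g :: "'n::finite symbol"
  assumes "nondegenerate g" "invertible C"
    and g: "variation g g' N p p'"
    and h: "variation (\<lambda>k. g k ** C) (\<lambda>k. g' k ** C) N q q'"
    and pq: "\<And>a. a \<le> N \<Longrightarrow> q a = p a"
    and "a \<le> N"
  shows "q' a = p' a"
proof (cases "a = N")
  case True
  then show ?thesis using g h by (simp add: variation_def)
next
  case False
  have lt: "(\<Sum>a\<le>N. r a ** f a) = (\<Sum>a<N. r a ** f a)" if "r N = 0" for r f :: "nat \<Rightarrow> 'n cmat"
    using that by (simp flip: lessThan_Suc_atMost)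
  have "q' a - p' a = 0"
  proof (rule nondegenerateD[OF assms(1)])
    fix b assume b: "b < N"
    have "((\<Sum>a\<le>N. q' a ** g (int b - int a)) + (\<Sum>a\<le>N. q a ** g' (int b - int a))) ** C = 0"
      using h b by (simp add: variation_def matrix_mult_sum_left matrix_mul_assoc matrix_add_rdistrib)
    then have "(\<Sum>a\<le>N. q' a ** g (int b - int a)) + (\<Sum>a\<le>N. q a ** g' (int b - int a)) = 0"
      by (simp add: invertible_mult_right_eq_zero_iff[OF assms(2)])
    moreover have "(\<Sum>a\<le>N. q a ** g' (int b - int a)) = (\<Sum>a\<le>N. p a ** g' (int b - int a))"
      using pq by simp
    moreover have "(\<Sum>a\<le>N. p' a ** g (int b - int a)) + (\<Sum>a\<le>N. p a ** g' (int b - int a)) = 0"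
      using g b by (simp add: variation_def)
    ultimately have "(\<Sum>a\<le>N. q' a ** g (int b - int a)) + (\<Sum>a\<le>N. p a ** g' (int b - int a))
        = (\<Sum>a\<le>N. p' a ** g (int b - int a)) + (\<Sum>a\<le>N. p a ** g' (int b - int a))"
      by simp
    then have "(\<Sum>a\<le>N. q' a ** g (int b - int a)) = (\<Sum>a\<le>N. p' a ** g (int b - int a))"
      by (rule add_right_imp_eq)
    moreover have "q' N = 0" "p' N = 0" using g h by (auto simp: variation_def)
    ultimately show "(\<Sum>a<N. (q' a - p' a) ** g (int b - int a)) = 0"
      by (simp add: matrix_diff_rdistrib sum_subtractf lt)
  qed (use False \<open>a \<le> N\<close> in simp)
  then show ?thesis by simp
qed

subsection \<open>Szego recursion\<close>

text \<open>This is P_{N+1}(z) = z P_N(z) + x Q_N(z) in coefficients, where x = P_{N+1}(0) and Q_N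
  is the reversed polynomial of \<open>q N\<close>. The constant terms agree since
  \<open>q N N\<close> is 1. Dividing the defect by z leaves a polynomial of degree below
  \<open>N\<close> that satisfies all \<open>N\<close> homogeneous relations.\<close>

lemma szego:
  fixes g :: "'n::finite symbol"
  assumes g: "nondegenerate g" and p: "monic_orthogonal g p"
    and q: "monic_orthogonal (\<lambda>k. g (- k)) q"
    and "a \<le> Suc N"
  shows "p (Suc N) a = (if a = 0 then 0 else p N (a - 1))
           + p (Suc N) 0 ** (if a \<le> N then q N (N - a) else 0)"
proof (cases a)
  case 0
  then show ?thesis using monic_orthogonal_leading[OF q, of N] by simp
next
  case (Suc a')
  define x where "x = p (Suc N) 0"
  \<comment> \<open>The reversed polynomial of \<open>q N\<close> without its constant term, divided
    by z; hence \<open>r N = 0\<close>.\<close>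
  define r where "r a = (if a < N then q N (N - Suc a) else 0)" for a
  define d where "d a = p (Suc N) (Suc a) - p N a - x ** r a" for a
  have dN: "d N = 0" using monic_orthogonal_leading[OF p, of N] monic_orthogonal_leading[OF p, of "Suc N"]
    by (simp add: d_def r_def)
  have "d a' = 0" if "a' < N"
  proof (rule nondegenerateD[OF g _ that])
    fix b assume b: "b < N"
    \<comment> \<open>Relation \<open>Suc b\<close> of \<open>p (Suc N)\<close> lacks its term
      \<open>a = 0\<close>, and the relation of \<open>q N\<close> read backwards lacks its leading
      term. Both missing terms are multiples of \<open>g (b + 1)\<close>, and they cancel in
      \<open>d\<close>.\<close>
    have 1: "(\<Sum>a\<le>N. p (Suc N) (Suc a) ** g (int b - int a)) = - (x ** g (int b + 1))"
      using monic_orthogonal_sum[OF p, of "Suc b" "Suc N"] b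
      by (simp add: sum.atMost_Suc_shift x_def add.commute eq_neg_iff_add_eq_0 del: sum.atMost_Suc)
    have 2: "(\<Sum>a\<le>N. p N a ** g (int b - int a)) = 0"
      using monic_orthogonal_sum[OF p b] .
    have "(\<Sum>a\<le>N. r a ** g (int b - int a)) = (\<Sum>a<N. q N (N - Suc a) ** g (int b - int a))"
      by (simp add: r_def flip: lessThan_Suc_atMost)
    also have "\<dots> = (\<Sum>a<N. q N (N - Suc a) ** g (- (int (N - Suc b) - int (N - Suc a))))"
      using b by (intro sum.cong refl arg_cong2[of _ _ _ _ "(**)"] arg_cong[of _ _ g]) auto
    also have "\<dots> = (\<Sum>a<N. q N a ** g (- (int (N - Suc b) - int a)))"
      by (rule sum.nat_diff_reindex)
    also have "\<dots> = - g (int b + 1)"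
    proof -
      have "- (int (N - Suc b) - int N) = int b + 1" using b by simp
      then show ?thesis
        using monic_orthogonal_sum[OF q, of "N - Suc b" N] b monic_orthogonal_leading[OF q, of N]
        by (simp add: eq_neg_iff_add_eq_0 add.commute[of "int b" 1] flip: lessThan_Suc_atMost)
    qed
    finally have 3: "(\<Sum>a\<le>N. r a ** g (int b - int a)) = - g (int b + 1)" .
    have "(\<Sum>a<N. d a ** g (int b - int a)) = (\<Sum>a\<le>N. d a ** g (int b - int a))"
      using dN by (simp flip: lessThan_Suc_atMost)
    also have "\<dots> = (\<Sum>a\<le>N. p (Suc N) (Suc a) ** g (int b - int a))
        - (\<Sum>a\<le>N. p N a ** g (int b - int a)) - x ** (\<Sum>a\<le>N. r a ** g (int b - int a))"
      by (simp add: d_def matrix_diff_rdistrib sum_subtractf matrix_mult_sum_right matrix_mul_assoc)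
    also have "\<dots> = 0"
      unfolding 1 2 3 using matrix_diff_ldistrib[of x 0 "g (int b + 1)"] by simp
    finally show "(\<Sum>a<N. d a ** g (int b - int a)) = 0" .
  qed
  then have "d a' = 0" using dN \<open>a \<le> Suc N\<close> Suc by (cases "a' = N") auto
  then show ?thesis using Suc by (auto simp: d_def r_def x_def algebra_simps)
qed

text \<open>If A x y = A, the two recursions give A P = A x Q in degree \<open>N + 1\<close>, with Q
  the reversed polynomial of \<open>q (Suc N)\<close>. The left side satisfies the relations up to
  \<open>N\<close>, the right side the relation \<open>N + 1\<close>, so A P vanishes together with
  its leading coefficient A.\<close>

lemma szego_invertible:
  fixes g :: "'n::finite symbol"
  assumes g: "nondegenerate g" and p: "monic_orthogonal g p"
    and q: "monic_orthogonal (\<lambda>k. g (- k)) q"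
  shows "invertible (mat 1 - p (Suc N) 0 ** q (Suc N) 0)"
proof (rule invertible_if_left_cancel)
  fix A :: "'n cmat"
  define x y where "x = p (Suc N) 0" and "y = q (Suc N) 0"
  assume "A ** (mat 1 - p (Suc N) 0 ** q (Suc N) 0) = 0"
  then have A: "A ** x ** y = A"
    by (simp add: x_def y_def matrix_diff_ldistrib matrix_mul_assoc)
  have coeff: "A ** p (Suc N) a = (A ** x) ** q (Suc N) (Suc N - a)" if "a \<le> Suc N" for a
  proof -
    define u where "u = (if a = 0 then 0 else p N (a - 1))"
    define v where "v = (if a \<le> N then q N (N - a) else 0)"
    have "p (Suc N) a = u + x ** v" using szego[OF g p q that] by (simp add: u_def v_def x_def)
    moreover have "q (Suc N) (Suc N - a) = v + y ** u"
      using szego[OF nondegenerate_reflect[OF g] q, of p "Suc N - a" N] p that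
        monic_orthogonal_leading[OF p, of N]
      by (cases "a = Suc N") (auto simp: u_def v_def y_def Suc_diff_le)
    ultimately show ?thesis
      by (simp add: matrix_add_ldistrib matrix_mul_assoc A)
  qed
  have "A ** p (Suc N) (Suc N) = 0"
  proof (rule nondegenerateD[OF g, where N = "Suc (Suc N)" and c = "\<lambda>a. A ** p (Suc N) a"])
    fix b assume b: "b < Suc (Suc N)"
    show "(\<Sum>a<Suc (Suc N). A ** p (Suc N) a ** g (int b - int a)) = 0"
    \<comment> \<open>The one relation that \<open>p (Suc N)\<close> does not supply is relation 0
      of \<open>q (Suc N)\<close>, read backwards.\<close>
    proof (cases "b = Suc N")
      case True
      have "(\<Sum>a<Suc (Suc N). A ** p (Suc N) a ** g (int b - int a))
          = (\<Sum>a<Suc (Suc N). A ** x ** q (Suc N) (Suc (Suc N) - Suc a) ** g (- (int 0 - int (Suc (Suc N) - Suc a))))"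
        using True by (intro sum.cong refl) (auto simp: coeff of_nat_diff)
      also have "\<dots> = (\<Sum>a<Suc (Suc N). A ** x ** q (Suc N) a ** g (- (int 0 - int a)))"
        by (rule sum.nat_diff_reindex)
      also have "\<dots> = A ** x ** (\<Sum>a\<le>Suc N. q (Suc N) a ** g (- (int 0 - int a)))"
        by (simp only: matrix_mult_sum_right matrix_mul_assoc lessThan_Suc_atMost)
      also have "\<dots> = 0" using monic_orthogonal_sum[OF q, of 0 "Suc N"] by simp
      finally show ?thesis .
    next
      case False
      then have "A ** (\<Sum>a\<le>Suc N. p (Suc N) a ** g (int b - int a)) = 0"
        using monic_orthogonal_sum[OF p, of b "Suc N"] b by simp
      then show ?thesis by (simp only: matrix_mult_sum_right matrix_mul_assoc lessThan_Suc_atMost)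
    qed
  qed simp
  then show "A = 0" using monic_orthogonal_leading[OF p, of "Suc N"] by simp
qed

subsection \<open>Wave matrices\<close>

definition mat_poly :: "nat \<Rightarrow> (nat \<Rightarrow> 'n::finite cmat) \<Rightarrow> complex \<Rightarrow> 'n cmat" where
  "mat_poly N p z = (\<Sum>a\<le>N. mat (z ^ a) ** p a)"

text \<open>The second block is \<open>q\<close> in reversed order. The transposition in the
  reversed polynomials of the theorem is absorbed into the choice of \<open>q\<close>.\<close>

definition wave :: "nat \<Rightarrow> (nat \<Rightarrow> 'n::finite cmat) \<Rightarrow> (nat \<Rightarrow> 'n cmat) \<Rightarrow> complex \<Rightarrow> complex^'n^('n + 'n)" where
  "wave N p q z = block_col (mat_poly N p z) (mat_poly N (\<lambda>a. q (N - a)) z)"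

lemma mat_power_Suc: "mat (z ^ Suc a) = mat z ** mat (z ^ a :: complex)"
  by (simp add: vec_eq_iff mat_mult_nth) (simp add: mat_def)

lemma mat_poly_cong: "(\<And>a. a \<le> N \<Longrightarrow> p a = q a) \<Longrightarrow> mat_poly N p z = mat_poly N q z"
  by (simp add: mat_poly_def)

lemma wave_cong:
  "(\<And>a. a \<le> N \<Longrightarrow> p a = p' a) \<Longrightarrow> (\<And>a. a \<le> N \<Longrightarrow> q a = q' a) \<Longrightarrow> wave N p q z = wave N p' q' z"
  unfolding wave_def by (intro arg_cong2[of _ _ _ _ block_col] mat_poly_cong) auto

lemma mat_poly_add: "mat_poly N (\<lambda>a. p a + q a) z = mat_poly N p z + mat_poly N q z"
  by (simp add: mat_poly_def matrix_add_ldistrib sum.distrib)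

lemma mat_poly_mult_left: "mat_poly N (\<lambda>a. x ** p a) z = x ** mat_poly N p z"
  by (simp add: mat_poly_def matrix_mult_sum_right matrix_mul_assoc mat_mult_commute)

lemma mat_poly_shift: "mat_poly (Suc N) (\<lambda>a. if a = 0 then 0 else p (a - 1)) z = mat z ** mat_poly N p z"
  by (simp add: mat_poly_def sum.atMost_Suc_shift matrix_mult_sum_right matrix_mul_assoc
      mat_power_Suc del: sum.atMost_Suc power_Suc)

lemma mat_poly_extend: "mat_poly (Suc N) (\<lambda>a. if a \<le> N then p a else 0) z = mat_poly N p z"
  by (simp add: mat_poly_def)

lemma mat_poly_0: "mat_poly N p 0 = p 0"
proof (cases N)
  case (Suc M)
  then show ?thesis by (simp add: mat_poly_def sum.atMost_Suc_shift del: sum.atMost_Suc)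
qed (simp add: mat_poly_def)

text \<open>One step of the recursion for both blocks of the wave matrix. The second line is the
  recursion for the reflected symbol, in which \<open>p\<close> and \<open>q\<close> change places,
  read backwards.\<close>

lemma szego_mat_poly:
  fixes g :: "'n::finite symbol"
  assumes g: "nondegenerate g" and p: "monic_orthogonal g p"
    and q: "monic_orthogonal (\<lambda>k. g (- k)) q"
  shows "mat_poly (Suc N) (p (Suc N)) z
           = mat z ** mat_poly N (p N) z + p (Suc N) 0 ** mat_poly N (\<lambda>a. q N (N - a)) z"
    and "mat_poly (Suc N) (\<lambda>a. q (Suc N) (Suc N - a)) z
           = mat_poly N (\<lambda>a. q N (N - a)) z + q (Suc N) 0 ** (mat z ** mat_poly N (p N) z)"
proof -
  have "mat_poly (Suc N) (p (Suc N)) z = mat_poly (Suc N) (\<lambda>a. (if a = 0 then 0 else p N (a - 1))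
      + p (Suc N) 0 ** (if a \<le> N then q N (N - a) else 0)) z"
    by (rule mat_poly_cong) (rule szego[OF g p q])
  then show "mat_poly (Suc N) (p (Suc N)) z
      = mat z ** mat_poly N (p N) z + p (Suc N) 0 ** mat_poly N (\<lambda>a. q N (N - a)) z"
    by (simp only: mat_poly_add mat_poly_mult_left mat_poly_shift mat_poly_extend)
  have "q (Suc N) (Suc N - a) = (if a \<le> N then q N (N - a) else 0)
      + q (Suc N) 0 ** (if a = 0 then 0 else p N (a - 1))" if "a \<le> Suc N" for a
    using szego[OF nondegenerate_reflect[OF g] q, of p "Suc N - a" N] p that
      monic_orthogonal_leading[OF p, of N]
    by (cases "a = Suc N") (auto simp: Suc_diff_le)
  then have "mat_poly (Suc N) (\<lambda>a. q (Suc N) (Suc N - a)) z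
      = mat_poly (Suc N) (\<lambda>a. (if a \<le> N then q N (N - a) else 0)
      + q (Suc N) 0 ** (if a = 0 then 0 else p N (a - 1))) z"
    by (rule mat_poly_cong)
  then show "mat_poly (Suc N) (\<lambda>a. q (Suc N) (Suc N - a)) z
      = mat_poly N (\<lambda>a. q N (N - a)) z + q (Suc N) 0 ** (mat z ** mat_poly N (p N) z)"
    by (simp only: mat_poly_add mat_poly_mult_left mat_poly_shift mat_poly_extend)
qed

lemma mat_mult_vec: "mat c *v v = (c :: complex) *s v"
  by (simp add: vec_eq_iff matrix_vector_mult_def mat_def if_distribR if_distrib cong: if_cong)

text \<open>For nonzero z the Szego step can be undone: w + x u = 0 and u + y w = 0 give (1 - x y) w
  = 0, hence w = 0 and u = 0, and the descent ends at P_0 = 1. At z = 0 the reversed polynomial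
  already has the value 1.\<close>

lemma mat_poly_kernel:
  fixes g :: "'n::finite symbol"
  assumes g: "nondegenerate g" and p: "monic_orthogonal g p"
    and q: "monic_orthogonal (\<lambda>k. g (- k)) q"
    and "mat_poly N (p N) z *v v = 0" and "mat_poly N (\<lambda>a. q N (N - a)) z *v v = 0"
  shows "v = 0"
proof (cases "z = 0")
  case True
  then show ?thesis using assms(5) monic_orthogonal_leading[OF q, of N] by (simp add: mat_poly_0)
next
  case False
  show ?thesis using assms(4,5)
  proof (induction N)
    case 0
    then show ?case using monic_orthogonal_leading[OF p, of 0] by (simp add: mat_poly_def)
  next
    case (Suc N)
    define x y where "x = p (Suc N) 0" and "y = q (Suc N) 0"
    define u where "u = mat_poly N (\<lambda>a. q N (N - a)) z *v v"
    define w where "w = mat z *v (mat_poly N (p N) z *v v)"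
    have 1: "w + x *v u = 0"
      using Suc.prems(1) szego_mat_poly(1)[OF g p q, of N z]
      by (simp add: matrix_vector_mult_add_rdistrib matrix_vector_mul_assoc u_def w_def x_def)
    have 2: "u + y *v w = 0"
      using Suc.prems(2) szego_mat_poly(2)[OF g p q, of N z]
      by (simp add: matrix_vector_mult_add_rdistrib matrix_vector_mul_assoc u_def w_def y_def)
    have "x *v u + x *v (y *v w) = 0"
      using arg_cong[OF 2, of "\<lambda>t. x *v t"] by (simp add: matrix_vector_right_distrib)
    then have "(mat 1 - x ** y) *v w = 0"
      using 1 by (simp add: matrix_vector_mult_diff_rdistrib matrix_vector_mul_assoc)
        (metis add.commute add_right_cancel)
    moreover obtain K where "K ** (mat 1 - x ** y) = mat 1"
      using szego_invertible[OF g p q, of N] by (auto simp: invertible_def x_def y_def)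
    ultimately have "w = 0"
      by (metis matrix_vector_mul_assoc matrix_vector_mul_lid matrix_vector_mult_0_right)
    then have "mat_poly N (p N) z *v v = 0" using False by (simp add: w_def mat_mult_vec)
    moreover have "u = 0" using 2 \<open>w = 0\<close> by simp
    ultimately show ?case by (intro Suc.IH) (simp_all add: u_def)
  qed
qed

section \<open>Wave matrix and derivative as functions of the reflection coefficients\<close>

lemma block_col_mult_vec_eq_0:
  "block_col A B *v v = 0 \<longleftrightarrow> A *v v = 0 \<and> B *v v = 0"
proof -
  have "(block_col A B *v v) $ Inl i = (A *v v) $ i" "(block_col A B *v v) $ Inr i = (B *v v) $ i" for i
    by (simp_all add: block_col_def matrix_vector_mult_def)
  then show ?thesis by (auto simp: vec_eq_iff split_sum_all)
qed

text \<open>\<open>W\<close> and \<open>W'\<close> are the values of the wave matrix and of its derivative along a flow acting on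
  the symbol by \<open>\<gamma>' = \<epsilon> z\<^sup>\<sigma> \<gamma>\<close>, for some symbol with reflection coefficients \<open>x\<close> and \<open>y\<close>.\<close>

definition wave_flow :: "complex \<Rightarrow> int \<Rightarrow> nat \<Rightarrow> (nat \<Rightarrow> 'n::finite cmat) \<Rightarrow> (nat \<Rightarrow> 'n cmat) \<Rightarrow> complex
    \<Rightarrow> complex^'n^('n + 'n) \<Rightarrow> complex^'n^('n + 'n) \<Rightarrow> bool" where
  "wave_flow \<epsilon> \<sigma> N x y z W W' \<longleftrightarrow>
     (\<exists>g p q p' q'. nondegenerate g \<and> monic_orthogonal g p \<and> monic_orthogonal (\<lambda>k. g (- k)) q \<and>
        (\<forall>j. p j 0 = x j) \<and> (\<forall>j. q j 0 = y j) \<and>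
        variation g (\<lambda>k. mat \<epsilon> ** g (k - \<sigma>)) N (p N) p' \<and>
        variation (\<lambda>k. g (- k)) (\<lambda>k. mat \<epsilon> ** g (- k - \<sigma>)) N (q N) q' \<and>
        W = wave N (p N) (q N) z \<and> W' = wave N p' q' z)"

text \<open>Two symbols with the same data differ by a constant right factor. The flow multiplies by
  a scalar and shifts the index, so it commutes with this factor, and
  \<open>variation_unique\<close> applies to both blocks.\<close>

lemma wave_flow_unique:
  assumes "wave_flow \<epsilon> \<sigma> N x y z W W'" and "wave_flow \<epsilon> \<sigma> N x y z V V'"
  shows "V = W" and "V' = W'"
proof -
  obtain g p q p' q' where g: "nondegenerate g" "monic_orthogonal g p" "monic_orthogonal (\<lambda>k. g (- k)) q"
    and x: "\<And>j. p j 0 = x j" and y: "\<And>j. q j 0 = y j"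
    and v: "variation g (\<lambda>k. mat \<epsilon> ** g (k - \<sigma>)) N (p N) p'"
      "variation (\<lambda>k. g (- k)) (\<lambda>k. mat \<epsilon> ** g (- k - \<sigma>)) N (q N) q'"
    and W: "W = wave N (p N) (q N) z" "W' = wave N p' q' z"
    using assms(1) unfolding wave_flow_def by auto
  obtain h r s r' s' where h: "nondegenerate h" "monic_orthogonal h r" "monic_orthogonal (\<lambda>k. h (- k)) s"
    and x': "\<And>j. r j 0 = x j" and y': "\<And>j. s j 0 = y j"
    and v': "variation h (\<lambda>k. mat \<epsilon> ** h (k - \<sigma>)) N (r N) r'"
      "variation (\<lambda>k. h (- k)) (\<lambda>k. mat \<epsilon> ** h (- k - \<sigma>)) N (s N) s'"
    and V: "V = wave N (r N) (s N) z" "V' = wave N r' s' z"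
    using assms(2) unfolding wave_flow_def by auto
  obtain C where C: "invertible C" "\<And>k. h k = g k ** C"
    and rp: "\<And>N a. a \<le> N \<Longrightarrow> r N a = p N a" and sq: "\<And>N a. a \<le> N \<Longrightarrow> s N a = q N a"
    using symbol_unique_up_to_factor[OF g h] x y x' y' by metis
  have h_eq: "h = (\<lambda>k. g k ** C)" using C(2) by blast
  show "V = W" unfolding V W using rp sq by (rule wave_cong)
  have "r' a = p' a" if "a \<le> N" for a
    using variation_unique[OF g(1) C(1) v(1), of "r N" r' a] v'(1) rp that
    by (simp add: h_eq matrix_mul_assoc)
  moreover have "s' a = q' a" if "a \<le> N" for a
    using variation_unique[OF nondegenerate_reflect[OF g(1)] C(1) v(2), of "s N" s' a] v'(2) sq that
    by (simp add: h_eq matrix_mul_assoc)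
  ultimately show "V' = W'" unfolding V W by (rule wave_cong)
qed

text \<open>The quantifier order is the point: \<open>M\<close> is chosen before any symbol. By
  uniqueness one solution of W' = M W serves every symbol with the given data; for data that no
  symbol realises, any matrix will do.\<close>

lemma wave_flow_matrix:
  "\<exists>M. \<forall>(x :: nat \<Rightarrow> 'n::finite cmat) y z W W'. wave_flow \<epsilon> \<sigma> N x y z W W' \<longrightarrow> W' = M x y z ** W"
proof -
  have "\<exists>M. \<forall>W W'. wave_flow \<epsilon> \<sigma> N x y z W W' \<longrightarrow> W' = M ** W"
    for x y :: "nat \<Rightarrow> 'n cmat" and z
  proof (cases "\<exists>W W'. wave_flow \<epsilon> \<sigma> N x y z W W'")
    case True
    then obtain W W' where W: "wave_flow \<epsilon> \<sigma> N x y z W W'" by blast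
    then have "v = 0" if "W *v v = 0" for v
      using that mat_poly_kernel unfolding wave_flow_def wave_def
      by (auto simp: block_col_mult_vec_eq_0)
    then obtain M where "W' = M ** W" using matrix_left_quotient by blast
    then show ?thesis using wave_flow_unique[OF W] by blast
  qed blast
  then show ?thesis by metis
qed

subsection \<open>Differentiating the orthogonality relations\<close>

lemma has_matrix_derivative_sum:
  assumes "\<And>a. a \<in> I \<Longrightarrow> has_matrix_derivative (F a) (F' a) u"
  shows "has_matrix_derivative (\<lambda>v. \<Sum>a\<in>I. F a v) (\<Sum>a\<in>I. F' a) u"
  using assms unfolding has_matrix_derivative_def sum_component by (auto intro: DERIV_sum)

lemma has_matrix_derivative_mult:
  assumes "has_matrix_derivative A A' u" "has_matrix_derivative B B' u"
  shows "has_matrix_derivative (\<lambda>v. A v ** B v) (A' ** B u + A u ** B') u"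
  unfolding has_matrix_derivative_def
proof (intro allI)
  fix a b
  have "((\<lambda>v. \<Sum>k\<in>UNIV. A v $ a $ k * B v $ k $ b) has_field_derivative
      (\<Sum>k\<in>UNIV. A' $ a $ k * B u $ k $ b + B' $ k $ b * A u $ a $ k)) (at u)"
    using assms unfolding has_matrix_derivative_def by (intro DERIV_sum DERIV_mult) auto
  then show "((\<lambda>v. (A v ** B v) $ a $ b) has_field_derivative (A' ** B u + A u ** B') $ a $ b) (at u)"
    by (simp add: matrix_matrix_mult_def sum.distrib mult.commute)
qed

lemma has_matrix_derivative_const: "has_matrix_derivative (\<lambda>v. A) 0 u"
  by (simp add: has_matrix_derivative_def)

lemma has_matrix_derivative_cmult:
  assumes "has_matrix_derivative B B' u"
  shows "has_matrix_derivative (\<lambda>v. A ** B v) (A ** B') u"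
  using has_matrix_derivative_mult[OF has_matrix_derivative_const assms] by simp

lemma has_matrix_derivative_transpose:
  "has_matrix_derivative F F' u \<Longrightarrow> has_matrix_derivative (\<lambda>v. transpose (F v)) (transpose F') u"
  by (simp add: has_matrix_derivative_def transpose_def)

lemma has_matrix_derivative_block_col:
  "has_matrix_derivative A A' u \<Longrightarrow> has_matrix_derivative B B' u \<Longrightarrow>
    has_matrix_derivative (\<lambda>v. block_col (A v) (B v)) (block_col A' B') u"
  by (simp add: has_matrix_derivative_def block_col_def split_sum_all)

lemma has_matrix_derivative_cong_ev:
  assumes "\<forall>\<^sub>F v in nhds u. F v = G v"
  shows "has_matrix_derivative F D u \<longleftrightarrow> has_matrix_derivative G D u"
  unfolding has_matrix_derivative_def
  by (intro all_cong1 DERIV_cong_ev refl eventually_mono[OF assms]) simp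

lemma has_matrix_derivative_unique:
  "has_matrix_derivative F A u \<Longrightarrow> has_matrix_derivative F B u \<Longrightarrow> A = B"
  unfolding has_matrix_derivative_def vec_eq_iff by (blast intro: DERIV_unique)

text \<open>The coefficients below the leading one solve a linear system with differentiable entries
  that is nondegenerate at \<open>u0\<close>, so they are differentiable there. The product rule
  then gives the variation.\<close>

lemma orthogonal_coefficients_derivative:
  fixes G :: "complex \<Rightarrow> 'n::finite symbol"
  assumes p: "\<forall>\<^sub>F u in nhds u0. monic_orthogonal (G u) (p u)"
    and G: "\<And>k. has_matrix_derivative (\<lambda>u. G u k) (G' k) u0"
    and nd: "nondegenerate (G u0)"
  shows "\<exists>p'. (\<forall>a\<le>N. has_matrix_derivative (\<lambda>u. p u N a) (p' a) u0) \<and>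
    variation (G u0) G' N (p u0 N) p'"
proof -
  define p' where "p' a = (if a = N then 0 else \<chi> i j. deriv (\<lambda>u. p u N a $ i $ j) u0)" for a
  have lead: "\<forall>\<^sub>F u in nhds u0. p u N N = mat 1"
    using p by eventually_elim (rule monic_orthogonal_leading)
  have G_diff: "(\<lambda>u. G u k $ i $ j) field_differentiable (at u0)" for k i j
    using G unfolding has_matrix_derivative_def field_differentiable_def by blast
  have diff: "(\<lambda>u. p u N a $ i $ j) field_differentiable (at u0)" if "a < N" for a i j
  proof -
    \<comment> \<open>Row \<open>i\<close> of the coefficients is fixed. Unknowns are indexed by
      degree \<open>a\<close> and column, equations by \<open>b\<close> and column; the leading term
      goes to the right-hand side.\<close>
    let ?I = "{..<N} \<times> (UNIV :: 'n set)"
    have "\<forall>x\<in>?I. (\<lambda>u. p u N (fst x) $ i $ snd x) field_differentiable (at u0)"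
    proof (rule linear_system_solution_differentiable[where J = ?I
          and T = "\<lambda>x y u. G u (int (fst y) - int (fst x)) $ snd x $ snd y"
          and r = "\<lambda>y u. - (G u (int (fst y) - int N) $ i $ snd y)"])
      show "finite ?I" by simp
      show "(\<lambda>u. G u (int (fst y) - int (fst x)) $ snd x $ snd y) field_differentiable (at u0)" for x y
        by (rule G_diff)
      show "(\<lambda>u. - (G u (int (fst y) - int N) $ i $ snd y)) field_differentiable (at u0)" for y
        by (intro derivative_intros G_diff)
    next
      fix y assume "y \<in> ?I"
      then obtain b j where y: "y = (b, j)" "b < N" by auto
      show "\<forall>\<^sub>F u in nhds u0. (\<Sum>x\<in>?I. p u N (fst x) $ i $ snd x *
          G u (int (fst y) - int (fst x)) $ snd x $ snd y) = - (G u (int (fst y) - int N) $ i $ snd y)"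
        using p
      proof eventually_elim
        case (elim u)
        have "(\<Sum>a<N. p u N a ** G u (int b - int a)) + G u (int b - int N) = 0"
          using monic_orthogonal_sum[OF elim y(2)] monic_orthogonal_leading[OF elim, of N]
          by (simp flip: lessThan_Suc_atMost)
        then have "((\<Sum>a<N. p u N a ** G u (int b - int a)) + G u (int b - int N)) $ i $ j = 0"
          by simp
        then show ?case
          by (simp add: y sum.cartesian_product' matrix_matrix_mult_def eq_neg_iff_add_eq_0)
      qed
    next
      fix v :: "nat \<times> 'n \<Rightarrow> complex" and x
      assume v: "\<And>y. y \<in> ?I \<Longrightarrow> (\<Sum>x\<in>?I. v x * G u0 (int (fst y) - int (fst x)) $ snd x $ snd y) = 0"
        and x: "x \<in> ?I"
      \<comment> \<open>The scalar solution is turned into matrix coefficients with all rows equal,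
        to which nondegeneracy applies.\<close>
      have "(\<chi> i j. v (fst x, j)) = (0 :: 'n cmat)"
      proof (rule nondegenerateD[OF nd, where c = "\<lambda>a. \<chi> i j. v (a, j)"])
        fix b assume "b < N"
        then show "(\<Sum>a<N. (\<chi> i j. v (a, j)) ** G u0 (int b - int a)) = 0"
          using v[of "(b, _)"]
          by (simp add: vec_eq_iff matrix_matrix_mult_def sum.cartesian_product')
      qed (use x in auto)
      then show "v x = 0" by (cases x) (simp add: vec_eq_iff)
    qed
    then show ?thesis using that by auto
  qed
  have p': "has_matrix_derivative (\<lambda>u. p u N a) (p' a) u0" if "a \<le> N" for a
  proof (cases "a = N")
    case True
    then show ?thesis
      using has_matrix_derivative_cong_ev[OF lead] has_matrix_derivative_const by (simp add: p'_def)
  next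
    case False
    then show ?thesis using diff[of a] that
      by (simp add: p'_def has_matrix_derivative_def DERIV_deriv_iff_field_differentiable)
  qed
  have "(\<Sum>a\<le>N. p' a ** G u0 (int b - int a)) + (\<Sum>a\<le>N. p u0 N a ** G' (int b - int a)) = 0"
    if "b < N" for b
  proof -
    have "has_matrix_derivative (\<lambda>u. \<Sum>a\<le>N. p u N a ** G u (int b - int a))
        (\<Sum>a\<le>N. p' a ** G u0 (int b - int a) + p u0 N a ** G' (int b - int a)) u0"
      by (intro has_matrix_derivative_sum has_matrix_derivative_mult p' G) simp
    moreover have ev: "\<forall>\<^sub>F u in nhds u0. (\<Sum>a\<le>N. p u N a ** G u (int b - int a)) = 0"
      using p by eventually_elim (rule monic_orthogonal_sum[OF _ that])
    have "has_matrix_derivative (\<lambda>u. \<Sum>a\<le>N. p u N a ** G u (int b - int a)) 0 u0"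
      unfolding has_matrix_derivative_cong_ev[OF ev] by (rule has_matrix_derivative_const)
    ultimately show ?thesis
      using has_matrix_derivative_unique by (fastforce simp: sum.distrib)
  qed
  then have "variation (G u0) G' N (p u0 N) p'" by (simp add: variation_def p'_def)
  with p' show ?thesis by blast
qed

lemma has_matrix_derivative_mat_poly:
  assumes "\<And>a. a \<le> N \<Longrightarrow> has_matrix_derivative (\<lambda>u. p u a) (p' a) u0"
  shows "has_matrix_derivative (\<lambda>u. mat_poly N (p u) z) (mat_poly N p' z) u0"
  unfolding mat_poly_def
  by (intro has_matrix_derivative_sum has_matrix_derivative_cmult assms) simp

lemma wave_flow_derivative:
  fixes G :: "complex \<Rightarrow> 'n::finite symbol"
  assumes p: "\<forall>\<^sub>F u in nhds u0. monic_orthogonal (G u) (p u)"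
    and q: "\<forall>\<^sub>F u in nhds u0. monic_orthogonal (\<lambda>k. G u (- k)) (q u)"
    and G: "\<And>k. has_matrix_derivative (\<lambda>u. G u k) (mat \<epsilon> ** G u0 (k - \<sigma>)) u0"
    and nd: "nondegenerate (G u0)"
  obtains W' where "has_matrix_derivative (\<lambda>u. wave N (p u N) (q u N) z) W' u0"
    and "wave_flow \<epsilon> \<sigma> N (\<lambda>j. p u0 j 0) (\<lambda>j. q u0 j 0) z (wave N (p u0 N) (q u0 N) z) W'"
proof -
  obtain p' where p': "\<And>a. a \<le> N \<Longrightarrow> has_matrix_derivative (\<lambda>u. p u N a) (p' a) u0"
    "variation (G u0) (\<lambda>k. mat \<epsilon> ** G u0 (k - \<sigma>)) N (p u0 N) p'"
    using orthogonal_coefficients_derivative[where N = N, OF p G nd] by blast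
  obtain q' where q': "\<And>a. a \<le> N \<Longrightarrow> has_matrix_derivative (\<lambda>u. q u N a) (q' a) u0"
    "variation (\<lambda>k. G u0 (- k)) (\<lambda>k. mat \<epsilon> ** G u0 (- k - \<sigma>)) N (q u0 N) q'"
    using orthogonal_coefficients_derivative[where N = N, OF q G nondegenerate_reflect[OF nd]] by blast
  show ?thesis
  proof (rule that)
    show "has_matrix_derivative (\<lambda>u. wave N (p u N) (q u N) z) (wave N p' q' z) u0"
      unfolding wave_def
      by (intro has_matrix_derivative_block_col has_matrix_derivative_mat_poly p' q') auto
    show "wave_flow \<epsilon> \<sigma> N (\<lambda>j. p u0 j 0) (\<lambda>j. q u0 j 0) z (wave N (p u0 N) (q u0 N) z) (wave N p' q' z)"
      unfolding wave_flow_def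
      using nd eventually_nhds_x_imp_x[OF p] eventually_nhds_x_imp_x[OF q] p'(2) q'(2)
      by (intro exI[of _ "G u0"] exI[of _ "p u0"] exI[of _ "q u0"] exI[of _ p'] exI[of _ q']) simp
  qed
qed

subsection \<open>Nondegeneracy from the triangular factorizations\<close>

text \<open>Forward substitution: relation \<open>b\<close> involves only \<open>d k\<close> with
  \<open>k \<le> b\<close>.\<close>

lemma upper_triangular_cancel:
  fixes B :: "'n::finite semi_inf"
  assumes upper: "\<And>i j. j < i \<Longrightarrow> B i j = 0" and inv: "\<And>i. invertible (B i i)"
    and sum: "\<And>b. b < N \<Longrightarrow> (\<Sum>k<N. d k ** B k b) = 0" and "b < N"
  shows "d b = 0"
  using \<open>b < N\<close>
proof (induction b rule: less_induct)
  case (less b)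
  have "(\<Sum>k<N. d k ** B k b) = (\<Sum>k\<in>{b}. d k ** B k b)"
  proof (rule sum.mono_neutral_right)
    show "\<forall>k\<in>{..<N} - {b}. d k ** B k b = 0"
      using less upper by (metis Diff_iff lessThan_iff linorder_neqE_nat singletonI times0_left times0_right)
  qed (use less in auto)
  then show ?case
    using sum[OF less.prems] by (simp add: invertible_mult_right_eq_zero_iff[OF inv])
qed

text \<open>Backward substitution, starting from \<open>b = N - 1\<close>.\<close>

lemma lower_triangular_cancel:
  fixes A :: "'n::finite semi_inf"
  assumes lower: "\<And>i j. i < j \<Longrightarrow> A i j = 0" and inv: "\<And>i. invertible (A i i)"
    and sum: "\<And>b. b < N \<Longrightarrow> (\<Sum>k<N. d k ** A k b) = 0" and "b < N"
  shows "d b = 0"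
  using \<open>b < N\<close>
proof (induction "N - b" arbitrary: b rule: less_induct)
  case less
  have "(\<Sum>k<N. d k ** A k b) = (\<Sum>k\<in>{b}. d k ** A k b)"
  proof (rule sum.mono_neutral_right)
    have "d k ** A k b = 0" if "k < N" "k \<noteq> b" for k
    proof (cases "k < b")
      case True
      then show ?thesis by (simp add: lower)
    next
      case False
      then have "d k = 0" using that by (intro less.hyps) auto
      then show ?thesis by simp
    qed
    then show "\<forall>k\<in>{..<N} - {b}. d k ** A k b = 0" by simp
  qed (use less in auto)
  then show ?case
    using sum[OF less.prems] by (simp add: invertible_mult_right_eq_zero_iff[OF inv])
qed

text \<open>For a lower factor on the left and an upper one on the right, truncation commutes with
  the product. A left kernel vector \<open>c\<close> thus yields (cA)B = 0, where first
  \<open>B\<close> and then \<open>A\<close> cancels.\<close>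

lemma nondegenerate_lower_upper:
  fixes A B :: "'n::finite semi_inf"
  assumes A: "\<And>i j. i < j \<Longrightarrow> A i j = 0" "\<And>i. invertible (A i i)"
    and B: "\<And>i j. j < i \<Longrightarrow> B i j = 0" "\<And>i. invertible (B i i)"
    and g: "\<And>a b. g (int b - int a) = (\<Sum>k\<le>a. A a k ** B k b)"
  shows "nondegenerate g"
  unfolding nondegenerate_def
proof (intro allI impI)
  fix N a and c :: "nat \<Rightarrow> 'n cmat"
  assume c: "\<forall>b<N. (\<Sum>a<N. c a ** g (int b - int a)) = 0" and a: "a < N"
  define d where "d k = (\<Sum>a<N. c a ** A a k)" for k
  have "(\<Sum>k<N. d k ** B k b) = 0" if "b < N" for b
  proof -
    have "g (int b - int a) = (\<Sum>k<N. A a k ** B k b)" if "a < N" for a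
      unfolding g using that A(1) by (intro sum.mono_neutral_left) auto
    then have "(\<Sum>a<N. c a ** g (int b - int a)) = (\<Sum>a<N. \<Sum>k<N. c a ** A a k ** B k b)"
      by (simp add: matrix_mult_sum_right matrix_mul_assoc)
    also have "\<dots> = (\<Sum>k<N. d k ** B k b)"
      unfolding d_def matrix_mult_sum_left by (rule sum.swap)
    finally show ?thesis using c that by simp
  qed
  then have "d k = 0" if "k < N" for k
    using upper_triangular_cancel[of B N d k] B that by blast
  then show "c a = 0"
    using lower_triangular_cancel[of A N c a] A a unfolding d_def by blast
qed

text \<open>An inverse in the sense of \<open>semi_inverse\<close> is not triangular by definition.
  Row \<open>i\<close> of the product, read by induction on \<open>i\<close>, reduces above the
  diagonal to \<open>A i i ** B i j = 0\<close>.\<close>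

lemma lower_right_inverse:
  fixes A B :: "'n::finite semi_inf"
  assumes inv: "\<And>i. invertible (A i i)"
    and one: "\<And>i j. (\<Sum>k\<le>i. A i k ** B k j) = semi_one i j"
  shows "i < j \<Longrightarrow> B i j = 0" and "invertible (B i i)"
proof -
  show lower: "B i j = 0" if "i < j" for i j
    using that
  proof (induction i rule: less_induct)
    case (less i)
    have "A i i ** B i j = (\<Sum>k\<le>i. A i k ** B k j)"
      using less by (simp flip: lessThan_Suc_atMost)
    then have 0: "A i i ** B i j = 0" using less by (simp add: one semi_one_def)
    obtain L where "L ** A i i = mat 1" using inv by (auto simp: invertible_def)
    then have "B i j = L ** (A i i ** B i j)" by (simp add: matrix_mul_assoc)
    then show ?case using 0 by simp
  qed
  have "A i i ** B i i = (\<Sum>k\<le>i. A i k ** B k i)"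
    using lower by (simp flip: lessThan_Suc_atMost)
  then have "A i i ** B i i = mat 1" by (simp add: one semi_one_def)
  then show "invertible (B i i)" using invertible_left_inverse by blast
qed

text \<open>Triangularity bounds the support in \<open>semi_mult\<close>, so the sum is a genuine
  finite one.\<close>

lemma semi_mult_lower:
  assumes "\<And>i j. i < j \<Longrightarrow> A i j = 0"
  shows "semi_mult A B i j = (\<Sum>k\<le>i. A i k ** B k j)"
  unfolding semi_mult_def
  by (rule sum.mono_neutral_left) (use assms in \<open>auto simp: not_less[symmetric]\<close>)

lemma semi_mult_upper:
  assumes "\<And>i j. j < i \<Longrightarrow> B i j = 0"
  shows "semi_mult A B i j = (\<Sum>k\<le>j. A i k ** B k j)"
  unfolding semi_mult_def
  by (rule sum.mono_neutral_left) (use assms in \<open>auto simp: not_less[symmetric]\<close>)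

lemma invertible_one: "invertible (mat 1 :: 'a::semiring_1^'n^'n)"
  unfolding invertible_def by (rule exI[of _ "mat 1"]) simp

lemma invertible_transpose:
  fixes A :: "'a::field^'n^'n"
  shows "invertible (transpose A) \<longleftrightarrow> invertible A"
  by (simp only: invertible_left_inverse[of "transpose A"] left_invertible_transpose
      invertible_right_inverse[of A])

text \<open>The factorization of T^l is already of the form lower times upper. That of T^r is upper
  on the right; transposing both block indices and blocks makes it lower times upper for the
  transposed symbol.\<close>

lemma factorizable_nondegenerate:
  assumes "factorizable (\<gamma> :: 'n::finite symbol)"
  shows "nondegenerate \<gamma>" and "nondegenerate (\<lambda>k. transpose (\<gamma> k))"
proof -
  obtain S1 S1' S2 where S: "lower_unitriangular S1" "semi_inverse S1 S1'" "upper_invertible S2"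
    "toeplitz_l \<gamma> = semi_mult S1' S2"
    using assms unfolding factorizable_def by blast
  have S1: "S1 i j = 0" if "i < j" for i j
    using S(1) that by (simp add: lower_unitriangular_def)
  have S1_inv: "invertible (S1 i i)" for i
    using S(1) by (simp add: lower_unitriangular_def invertible_one)
  have "(\<Sum>k\<le>i. S1 i k ** S1' k j) = semi_one i j" for i j
    using S(2) by (simp add: semi_inverse_def flip: semi_mult_lower[where A = S1, OF S1])
  note S1' = lower_right_inverse[of S1 S1', OF S1_inv this]
  show "nondegenerate \<gamma>"
  proof (rule nondegenerate_lower_upper[OF S1'])
    show "\<gamma> (int b - int a) = (\<Sum>k\<le>a. S1' a k ** S2 k b)" for a b
      using fun_cong[OF fun_cong[OF S(4)], of a b]
      by (simp add: toeplitz_l_def semi_mult_lower[where A = S1', OF S1'(1)])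
  qed (use S(3) in \<open>auto simp: upper_invertible_def\<close>)
  obtain Z1 Z1' Z2 where Z: "upper_invertible Z1" "semi_inverse Z1 Z1'" "lower_unitriangular Z2"
    "toeplitz_r \<gamma> = semi_mult Z2 Z1'"
    using assms unfolding factorizable_def by blast
  have Z1: "Z1 i j = 0" if "j < i" for i j
    using Z(1) that by (simp add: upper_invertible_def)
  have Z1_inv: "invertible (transpose (Z1 i i))" for i
    using Z(1) by (simp add: upper_invertible_def invertible_transpose)
  \<comment> \<open>The transpose of \<open>Z1' Z1 = 1\<close> exhibits a right inverse of the lower
    triangular transpose of \<open>Z1\<close>.\<close>
  have "(\<Sum>k\<le>i. transpose (Z1 k i) ** transpose (Z1' j k)) = semi_one i j" for i j
  proof -
    have "(\<Sum>k\<le>i. transpose (Z1 k i) ** transpose (Z1' j k)) = transpose (semi_mult Z1' Z1 j i)"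
      by (simp add: semi_mult_upper[where B = Z1, OF Z1] transpose_sum matrix_transpose_mul)
    then show ?thesis using Z(2) by (auto simp: semi_inverse_def semi_one_def transpose_zero)
  qed
  note Z1'T = lower_right_inverse[of "\<lambda>i k. transpose (Z1 k i)" "\<lambda>k j. transpose (Z1' j k)", OF Z1_inv this]
  have Z1': "Z1' i j = 0" if "j < i" for i j
    using Z1'T(1)[OF that] by (simp add: transpose_eq_zero_iff)
  show "nondegenerate (\<lambda>k. transpose (\<gamma> k))"
  proof (rule nondegenerate_lower_upper[OF Z1'T])
    show "transpose (\<gamma> (int b - int a)) = (\<Sum>k\<le>a. transpose (Z1' k a) ** transpose (Z2 b k))" for a b
      using fun_cong[OF fun_cong[OF Z(4)], of b a]
      by (simp add: toeplitz_r_def semi_mult_upper[where B = Z1', OF Z1'] transpose_sum matrix_transpose_mul)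
  qed (use Z(3) in \<open>auto simp: lower_unitriangular_def invertible_transpose invertible_one transpose_zero\<close>)
qed

subsection \<open>Biorthogonal polynomials\<close>

text \<open>This passes from orthogonality against the monic polynomials of degree below
  \<open>N\<close> to orthogonality against the monomials.\<close>

lemma unitriangular_cancel:
  fixes e :: "nat \<Rightarrow> nat \<Rightarrow> 'n::finite cmat"
  assumes "\<And>j. e j j = mat 1" and "\<And>j. j < N \<Longrightarrow> (\<Sum>b\<le>j. X b ** e j b) = 0" and "b < N"
  shows "X b = 0"
  using \<open>b < N\<close>
proof (induction b rule: less_induct)
  case (less b)
  then show ?case
    using assms(2)[of b] by (simp add: assms(1) flip: lessThan_Suc_atMost)
qed

text \<open>The pairs with \<open>j < k\<close> give the relations of \<open>p\<close>. Transposing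
  the pairing exchanges its arguments and replaces \<open>g k\<close> by the transpose of
  \<open>g (- k)\<close>, which gives those of \<open>e\<close>.\<close>

lemma biorthogonal_monic_orthogonal:
  fixes g :: "'n::finite symbol"
  assumes p: "\<And>j. p j j = mat 1" and e: "\<And>j. e j j = mat 1"
    and pe: "\<And>k j. k \<noteq> j \<Longrightarrow>
      (\<Sum>a\<le>k. \<Sum>b\<le>j. p k a ** g (int b - int a) ** transpose (e j b)) = 0"
  shows "monic_orthogonal g p" and "monic_orthogonal (\<lambda>k. transpose (g (- k))) e"
proof -
  show "monic_orthogonal g p"
    unfolding monic_orthogonal_def
  proof (intro allI conjI impI p)
    fix N b :: nat assume "b < N"
    show "(\<Sum>a\<le>N. p N a ** g (int b - int a)) = 0"
    proof (rule unitriangular_cancel[where e = "\<lambda>j b. transpose (e j b)"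
          and X = "\<lambda>b. \<Sum>a\<le>N. p N a ** g (int b - int a)", OF _ _ \<open>b < N\<close>])
      fix j assume "j < N"
      have "(\<Sum>b\<le>j. (\<Sum>a\<le>N. p N a ** g (int b - int a)) ** transpose (e j b))
          = (\<Sum>a\<le>N. \<Sum>b\<le>j. p N a ** g (int b - int a) ** transpose (e j b))"
        unfolding matrix_mult_sum_left by (rule sum.swap)
      then show "(\<Sum>b\<le>j. (\<Sum>a\<le>N. p N a ** g (int b - int a)) ** transpose (e j b)) = 0"
        using pe[of N j] \<open>j < N\<close> by simp
    qed (simp add: e)
  qed
  show "monic_orthogonal (\<lambda>k. transpose (g (- k))) e"
    unfolding monic_orthogonal_def
  proof (intro allI conjI impI e)
    fix N b :: nat assume "b < N"
    show "(\<Sum>a\<le>N. e N a ** transpose (g (- (int b - int a)))) = 0"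
    proof (rule unitriangular_cancel[where e = "\<lambda>j b. transpose (p j b)"
          and X = "\<lambda>b. \<Sum>a\<le>N. e N a ** transpose (g (- (int b - int a)))", OF _ _ \<open>b < N\<close>])
      fix j assume "j < N"
      have "transpose (\<Sum>a\<le>j. \<Sum>b\<le>N. p j a ** g (int b - int a) ** transpose (e N b)) = 0"
        using pe[of j N] \<open>j < N\<close> by (simp add: transpose_zero)
      then show "(\<Sum>b\<le>j. (\<Sum>a\<le>N. e N a ** transpose (g (- (int b - int a)))) ** transpose (p j b)) = 0"
        by (simp add: transpose_sum matrix_transpose_mul matrix_mult_sum_left matrix_mul_assoc)
    qed (simp add: p)
  qed
qed

lemma biorthogonal_l_monic_orthogonal:
  assumes "biorthogonal_l \<gamma> P1 P2"
  shows "monic_orthogonal \<gamma> (\<lambda>N. coeff (P1 N))"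
    and "monic_orthogonal (\<lambda>k. transpose (\<gamma> (- k))) (\<lambda>N. coeff (P2 N))"
proof -
  have P: "degree (P1 N) = N" "degree (P2 N) = N" "coeff (P1 N) N = mat 1" "coeff (P2 N) N = mat 1" for N
    using assms by (metis biorthogonal_l_def mp_monic_def)+
  have "(\<Sum>a\<le>k. \<Sum>b\<le>j. coeff (P1 k) a ** \<gamma> (int b - int a) ** transpose (coeff (P2 j) b)) = 0"
    if "k \<noteq> j" for k j
    using assms that by (simp add: biorthogonal_l_def pairing_l_def P)
  note * = biorthogonal_monic_orthogonal[of "\<lambda>N. coeff (P1 N)" "\<lambda>N. coeff (P2 N)" \<gamma>, OF P(3,4) this]
  show "monic_orthogonal \<gamma> (\<lambda>N. coeff (P1 N))"
    and "monic_orthogonal (\<lambda>k. transpose (\<gamma> (- k))) (\<lambda>N. coeff (P2 N))"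
    using * by simp_all
qed

text \<open>The right pairing of \<open>P2\<close> with \<open>P1\<close> is the left pairing of
  their transposed coefficients for the reflected symbol, with \<open>P2\<close> as first
  argument.\<close>

lemma biorthogonal_r_monic_orthogonal:
  assumes "biorthogonal_r \<gamma> P1 P2"
  shows "monic_orthogonal (\<lambda>k. transpose (\<gamma> k)) (\<lambda>N a. transpose (coeff (P1 N) a))"
    and "monic_orthogonal (\<lambda>k. \<gamma> (- k)) (\<lambda>N a. transpose (coeff (P2 N) a))"
proof -
  have P: "degree (P1 N) = N" "degree (P2 N) = N" "transpose (coeff (P1 N) N) = mat 1"
    "transpose (coeff (P2 N) N) = mat 1" for N
    using assms by (metis biorthogonal_r_def mp_monic_def transpose_mat)+
  have "(\<Sum>a\<le>k. \<Sum>b\<le>j. transpose (coeff (P2 k) a) ** \<gamma> (- (int b - int a)) **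
      transpose (transpose (coeff (P1 j) b))) = 0"
    if "k \<noteq> j" for k j
    using assms that by (simp add: biorthogonal_r_def pairing_r_def P)
  note * = biorthogonal_monic_orthogonal[of "\<lambda>N a. transpose (coeff (P2 N) a)"
      "\<lambda>N a. transpose (coeff (P1 N) a)" "\<lambda>k. \<gamma> (- k)", OF P(4,3) this]
  show "monic_orthogonal (\<lambda>k. transpose (\<gamma> k)) (\<lambda>N a. transpose (coeff (P1 N) a))"
    and "monic_orthogonal (\<lambda>k. \<gamma> (- k)) (\<lambda>N a. transpose (coeff (P2 N) a))"
    using * by simp_all
qed

section \<open>Wave matrices of the biorthogonal polynomials\<close>

lemma mp_eval_mat_poly: "degree P \<le> N \<Longrightarrow> mp_eval P z = mat_poly N (coeff P) z"
  unfolding mp_eval_def mat_poly_def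
  by (rule sum.mono_neutral_left) (auto simp: coeff_eq_0)

lemma mp_eval_0: "mp_eval P 0 = coeff P 0"
  by (simp add: mp_eval_mat_poly[of P "degree P"] mat_poly_0)

lemma mp_eval_reversed:
  "mp_eval (mp_reversed Q) z = mat_poly (degree Q) (\<lambda>a. transpose (coeff Q (degree Q - a))) z"
proof -
  \<comment> \<open>Only an inequality: the degree drops when \<open>coeff Q 0\<close>
    vanishes.\<close>
  have "degree (mp_reversed Q) \<le> degree Q"
    unfolding mp_reversed_def
    using degree_reflect_poly_le[of Q]
    by (intro degree_le) (simp add: coeff_map_poly transpose_zero coeff_eq_0)
  then have "mp_eval (mp_reversed Q) z = mat_poly (degree Q) (coeff (mp_reversed Q)) z"
    by (rule mp_eval_mat_poly)
  also have "\<dots> = mat_poly (degree Q) (\<lambda>a. transpose (coeff Q (degree Q - a))) z"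
    by (rule mat_poly_cong) (simp add: mp_reversed_def coeff_map_poly transpose_zero coeff_reflect_poly)
  finally show ?thesis .
qed

lemma psi_l_wave:
  assumes "degree (P1 N) = N" "degree (P2 N) = N"
  shows "psi_l P1 P2 N z = wave N (coeff (P1 N)) (\<lambda>a. transpose (coeff (P2 N) a)) z"
  using assms by (simp add: psi_l_def wave_def mp_eval_mat_poly[of "P1 N" N] mp_eval_reversed)

lemma transpose_block_row: "transpose (block_row A B) = block_col (transpose A) (transpose B)"
  by (simp add: vec_eq_iff transpose_def block_row_def block_col_def split: sum.split)

lemma transpose_mat_poly: "transpose (mat_poly N p z) = mat_poly N (\<lambda>a. transpose (p a)) z"
  by (simp add: mat_poly_def transpose_sum matrix_transpose_mul mat_mult_commute)

lemma transpose_psi_r_wave: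
  assumes "degree (P1 N) = N" "degree (P2 N) = N"
  shows "transpose (psi_r P1 P2 N z) = wave N (\<lambda>a. transpose (coeff (P1 N) a)) (coeff (P2 N)) z"
  using assms by (simp add: psi_r_def wave_def transpose_block_row transpose_mat_poly
      mp_eval_mat_poly[of "P1 N" N] mp_eval_reversed)

text \<open>The right-hand case is the left-hand one for the transposed symbol, whose data are the
  transposes of x^r and y^l. Transposing back puts \<open>M\<close> transposed on the right, so a
  single \<open>M\<close> serves both.\<close>

lemma psi_derivative:
  fixes G :: "complex \<Rightarrow> 'n::finite symbol"
  assumes l: "\<forall>\<^sub>F u in nhds u0. biorthogonal_l (G u) (P1l u) (P2l u)"
    and r: "\<forall>\<^sub>F u in nhds u0. biorthogonal_r (G u) (P1r u) (P2r u)"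
    and G: "\<And>k. has_matrix_derivative (\<lambda>u. G u k) (mat \<epsilon> ** G u0 (k - \<sigma>)) u0"
    and f: "factorizable (G u0)"
    and M: "\<And>(x :: nat \<Rightarrow> 'n cmat) y z W W'. wave_flow \<epsilon> \<sigma> N x y z W W' \<Longrightarrow> W' = M x y z ** W"
  shows "has_matrix_derivative (\<lambda>u. psi_l (P1l u) (P2r u) N z)
      (M (refl_x (P1l u0)) (refl_y (P2r u0)) z ** psi_l (P1l u0) (P2r u0) N z) u0"
    and "has_matrix_derivative (\<lambda>u. psi_r (P1r u) (P2l u) N z)
      (psi_r (P1r u0) (P2l u0) N z ** transpose (M (\<lambda>j. transpose (refl_x (P1r u0) j))
        (\<lambda>j. transpose (refl_y (P2l u0) j)) z)) u0"
proof -
  have deg: "\<forall>\<^sub>F u in nhds u0. degree (P1l u N) = N \<and> degree (P2l u N) = N \<and> degree (P1r u N) = N \<and>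
      degree (P2r u N) = N"
    using l r by eventually_elim (auto simp: biorthogonal_l_def biorthogonal_r_def mp_monic_def)
  have psi: "\<forall>\<^sub>F u in nhds u0. psi_l (P1l u) (P2r u) N z
      = wave N (coeff (P1l u N)) (\<lambda>a. transpose (coeff (P2r u N) a)) z"
    using deg by eventually_elim (simp add: psi_l_wave)
  have psi': "\<forall>\<^sub>F u in nhds u0. transpose (psi_r (P1r u) (P2l u) N z)
      = wave N (\<lambda>a. transpose (coeff (P1r u N) a)) (coeff (P2l u N)) z"
    using deg by eventually_elim (simp add: transpose_psi_r_wave)
  obtain W where
    W: "has_matrix_derivative (\<lambda>u. wave N (coeff (P1l u N)) (\<lambda>a. transpose (coeff (P2r u N) a)) z) W u0"
      "wave_flow \<epsilon> \<sigma> N (\<lambda>j. coeff (P1l u0 j) 0) (\<lambda>j. transpose (coeff (P2r u0 j) 0)) z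
        (wave N (coeff (P1l u0 N)) (\<lambda>a. transpose (coeff (P2r u0 N) a)) z) W"
    using wave_flow_derivative[of G "\<lambda>u N. coeff (P1l u N)" u0 "\<lambda>u N a. transpose (coeff (P2r u N) a)",
        OF eventually_mono[OF l biorthogonal_l_monic_orthogonal(1)]
          eventually_mono[OF r biorthogonal_r_monic_orthogonal(2)] G factorizable_nondegenerate(1)[OF f]] .
  show "has_matrix_derivative (\<lambda>u. psi_l (P1l u) (P2r u) N z)
      (M (refl_x (P1l u0)) (refl_y (P2r u0)) z ** psi_l (P1l u0) (P2r u0) N z) u0"
    unfolding has_matrix_derivative_cong_ev[OF psi] eventually_nhds_x_imp_x[OF psi]
    using W(1) M[OF W(2)] by (simp add: refl_x_def[abs_def] refl_y_def[abs_def] mp_eval_0)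
  have GT: "has_matrix_derivative (\<lambda>u. transpose (G u k)) (mat \<epsilon> ** transpose (G u0 (k - \<sigma>))) u0" for k
    using has_matrix_derivative_transpose[OF G[of k]] by (simp add: matrix_transpose_mul mat_mult_commute)
  obtain V where
    V: "has_matrix_derivative (\<lambda>u. wave N (\<lambda>a. transpose (coeff (P1r u N) a)) (coeff (P2l u N)) z) V u0"
      "wave_flow \<epsilon> \<sigma> N (\<lambda>j. transpose (coeff (P1r u0 j) 0)) (\<lambda>j. coeff (P2l u0 j) 0) z
        (wave N (\<lambda>a. transpose (coeff (P1r u0 N) a)) (coeff (P2l u0 N)) z) V"
    using wave_flow_derivative[of "\<lambda>u k. transpose (G u k)" "\<lambda>u N a. transpose (coeff (P1r u N) a)" u0
        "\<lambda>u N. coeff (P2l u N)",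
        OF eventually_mono[OF r biorthogonal_r_monic_orthogonal(1)]
          eventually_mono[OF l biorthogonal_l_monic_orthogonal(2)] GT factorizable_nondegenerate(2)[OF f]] .
  have "has_matrix_derivative (\<lambda>u. transpose (psi_r (P1r u) (P2l u) N z))
      (M (\<lambda>j. transpose (refl_x (P1r u0) j)) (\<lambda>j. transpose (refl_y (P2l u0) j)) z
        ** transpose (psi_r (P1r u0) (P2l u0) N z)) u0"
    unfolding has_matrix_derivative_cong_ev[OF psi'] eventually_nhds_x_imp_x[OF psi']
    using V(1) M[OF V(2)] by (simp add: refl_x_def refl_y_def mp_eval_0)
  from has_matrix_derivative_transpose[OF this]
  show "has_matrix_derivative (\<lambda>u. psi_r (P1r u) (P2l u) N z)
      (psi_r (P1r u0) (P2l u0) N z ** transpose (M (\<lambda>j. transpose (refl_x (P1r u0) j))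
        (\<lambda>j. transpose (refl_y (P2l u0) j)) z)) u0"
    by (simp add: matrix_transpose_mul)
qed

subsection \<open>The Lax matrices\<close>

theorem theorem6p4:
  fixes i N :: nat
  assumes "i \<ge> 1"
  shows "\<exists>(Mlt :: (nat \<Rightarrow> 'n::finite cmat) \<Rightarrow> (nat \<Rightarrow> 'n cmat) \<Rightarrow> (nat \<Rightarrow> 'n cmat) \<Rightarrow> (nat \<Rightarrow> 'n cmat)
               \<Rightarrow> complex \<Rightarrow> complex^('n + 'n)^('n + 'n)) Mls Mrt Mrs.
    \<forall>(\<gamma>0 :: 'n symbol) D \<gamma>
       (P1l :: times \<Rightarrow> times \<Rightarrow> nat \<Rightarrow> 'n matpoly) P2l P1r P2r.
      time_dependent_symbol \<gamma>0 D \<gamma> \<longrightarrow>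
      (\<forall>(t, s) \<in> D. factorizable (\<gamma> t s)) \<longrightarrow>
      (\<forall>(t, s) \<in> D. biorthogonal_l (\<gamma> t s) (P1l t s) (P2l t s)) \<longrightarrow>
      (\<forall>(t, s) \<in> D. biorthogonal_r (\<gamma> t s) (P1r t s) (P2r t s)) \<longrightarrow>
      (\<forall>(t, s) \<in> D. \<forall>z.
         let at_data = (\<lambda>M :: _ \<Rightarrow> _ \<Rightarrow> _ \<Rightarrow> _ \<Rightarrow> complex \<Rightarrow> complex^('n + 'n)^('n + 'n).
               M (refl_x (P1l t s)) (refl_y (P2l t s)) (refl_x (P1r t s)) (refl_y (P2r t s)) z)
         in
           has_matrix_derivative (\<lambda>u. psi_l (P1l (t(i := u)) s) (P2r (t(i := u)) s) N z)
             (at_data Mlt ** psi_l (P1l t s) (P2r t s) N z) (t i) \<and>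
           has_matrix_derivative (\<lambda>u. psi_l (P1l t (s(i := u))) (P2r t (s(i := u))) N z)
             (at_data Mls ** psi_l (P1l t s) (P2r t s) N z) (s i) \<and>
           has_matrix_derivative (\<lambda>u. psi_r (P1r (t(i := u)) s) (P2l (t(i := u)) s) N z)
             (psi_r (P1r t s) (P2l t s) N z ** at_data Mrt) (t i) \<and>
           has_matrix_derivative (\<lambda>u. psi_r (P1r t (s(i := u))) (P2l t (s(i := u))) N z)
             (psi_r (P1r t s) (P2l t s) N z ** at_data Mrs) (s i))"
proof -
  \<comment> \<open>The t-flow multiplies the symbol by z^i, the s-flow by - z^(- i); this fixes
    \<epsilon> and \<sigma>.\<close>
  obtain Mt :: "(nat \<Rightarrow> 'n cmat) \<Rightarrow> (nat \<Rightarrow> 'n cmat) \<Rightarrow> complex \<Rightarrow> complex^('n + 'n)^('n + 'n)"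
    where Mt: "\<And>x y z W W'. wave_flow 1 (int i) N x y z W W' \<Longrightarrow> W' = Mt x y z ** W"
    using wave_flow_matrix[of 1 "int i" N] by blast
  obtain Ms :: "(nat \<Rightarrow> 'n cmat) \<Rightarrow> (nat \<Rightarrow> 'n cmat) \<Rightarrow> complex \<Rightarrow> complex^('n + 'n)^('n + 'n)"
    where Ms: "\<And>x y z W W'. wave_flow (- 1) (- int i) N x y z W W' \<Longrightarrow> W' = Ms x y z ** W"
    using wave_flow_matrix[of "- 1" "- int i" N] by blast
  define right where "right M = (\<lambda>(xl :: nat \<Rightarrow> 'n cmat) (yl :: nat \<Rightarrow> 'n cmat) (xr :: nat \<Rightarrow> 'n cmat)
      (yr :: nat \<Rightarrow> 'n cmat) z. transpose (M (\<lambda>j. transpose (xr j)) (\<lambda>j. transpose (yl j)) z))"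
    for M :: "(nat \<Rightarrow> 'n cmat) \<Rightarrow> (nat \<Rightarrow> 'n cmat) \<Rightarrow> complex \<Rightarrow> complex^('n + 'n)^('n + 'n)"
  show ?thesis
  proof (rule exI[of _ "\<lambda>xl yl xr yr. Mt xl yr"], rule exI[of _ "\<lambda>xl yl xr yr. Ms xl yr"],
      rule exI[of _ "right Mt"], rule exI[of _ "right Ms"],
      intro allI impI ballI, unfold split_paired_all, unfold Let_def prod.case, intro allI conjI)
    fix \<gamma>0 :: "'n symbol" and D \<gamma> and P1l P2l P1r P2r :: "times \<Rightarrow> times \<Rightarrow> nat \<Rightarrow> 'n matpoly"
      and t s :: times and z :: complex
    assume \<gamma>: "time_dependent_symbol \<gamma>0 D \<gamma>"
      and f: "\<forall>(t, s) \<in> D. factorizable (\<gamma> t s)"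
      and l: "\<forall>(t, s) \<in> D. biorthogonal_l (\<gamma> t s) (P1l t s) (P2l t s)"
      and r: "\<forall>(t, s) \<in> D. biorthogonal_r (\<gamma> t s) (P1r t s) (P2r t s)"
      and ts: "(t, s) \<in> D"
    have near: "\<forall>\<^sub>F u in nhds (t i). (t(i := u), s) \<in> D" "\<forall>\<^sub>F u in nhds (s i). (t, s(i := u)) \<in> D"
      using \<gamma> ts assms unfolding time_dependent_symbol_def by blast+
    have deriv: "has_matrix_derivative (\<lambda>u. \<gamma> (t(i := u)) s k) (\<gamma> t s (k - int i)) (t i)"
      "has_matrix_derivative (\<lambda>u. \<gamma> t (s(i := u)) k) (- \<gamma> t s (k + int i)) (s i)" for k
      using \<gamma> ts assms unfolding time_dependent_symbol_def by blast+
    have minus: "mat (- 1) ** A = - A" for A :: "'n cmat" by (simp add: vec_eq_iff mat_mult_nth)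
    have "\<forall>\<^sub>F u in nhds (t i). biorthogonal_l (\<gamma> (t(i := u)) s) (P1l (t(i := u)) s) (P2l (t(i := u)) s)"
      "\<forall>\<^sub>F u in nhds (t i). biorthogonal_r (\<gamma> (t(i := u)) s) (P1r (t(i := u)) s) (P2r (t(i := u)) s)"
      using near(1) l r by (auto elim: eventually_mono)
    \<comment> \<open>At \<open>u = t i\<close> the updated times \<open>t(i := u)\<close> are
      \<open>t\<close> itself, which \<open>fun_upd_triv\<close> uses.\<close>
    note t_flow = psi_derivative[OF this _ _ Mt, unfolded fun_upd_triv]
    have "\<forall>\<^sub>F u in nhds (s i). biorthogonal_l (\<gamma> t (s(i := u))) (P1l t (s(i := u))) (P2l t (s(i := u)))"
      "\<forall>\<^sub>F u in nhds (s i). biorthogonal_r (\<gamma> t (s(i := u))) (P1r t (s(i := u))) (P2r t (s(i := u)))"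
      using near(2) l r by (auto elim: eventually_mono)
    note s_flow = psi_derivative[OF this _ _ Ms, unfolded fun_upd_triv]
    show "has_matrix_derivative (\<lambda>u. psi_l (P1l (t(i := u)) s) (P2r (t(i := u)) s) N z)
        (Mt (refl_x (P1l t s)) (refl_y (P2r t s)) z ** psi_l (P1l t s) (P2r t s) N z) (t i)"
      by (rule t_flow(1)) (use deriv(1) f ts in auto)
    show "has_matrix_derivative (\<lambda>u. psi_l (P1l t (s(i := u))) (P2r t (s(i := u))) N z)
        (Ms (refl_x (P1l t s)) (refl_y (P2r t s)) z ** psi_l (P1l t s) (P2r t s) N z) (s i)"
      by (rule s_flow(1)) (use deriv(2) f ts in \<open>auto simp: minus\<close>)
    show "has_matrix_derivative (\<lambda>u. psi_r (P1r (t(i := u)) s) (P2l (t(i := u)) s) N z)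
        (psi_r (P1r t s) (P2l t s) N z ** right Mt (refl_x (P1l t s)) (refl_y (P2l t s))
          (refl_x (P1r t s)) (refl_y (P2r t s)) z) (t i)"
      unfolding right_def by (rule t_flow(2)) (use deriv(1) f ts in auto)
    show "has_matrix_derivative (\<lambda>u. psi_r (P1r t (s(i := u))) (P2l t (s(i := u))) N z)
        (psi_r (P1r t s) (P2l t s) N z ** right Ms (refl_x (P1l t s)) (refl_y (P2l t s))
          (refl_x (P1r t s)) (refl_y (P2r t s)) z) (s i)"
      unfolding right_def by (rule s_flow(2)) (use deriv(2) f ts in \<open>auto simp: minus\<close>)
  qed
qed

end
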